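(* Assume ${\rm GBC}^-+{\rm ETR}$. Every well-founded class relation has a continuous ranking to some class well-order. Indeed, every ranking of a well-founded class relation by a class well-order can be refined to a continuous ranking: if $\pi$ is a ranking of the well-founded class relation $\langle X,\vartriangleleft\rangle$ by the class well-order $\langle\Gamma,\leq_\Gamma\rangle$, then there is a continuous ranking $\rho$ of $\vartriangleleft$ by $\Gamma$ with $\rho(x)\leq_\Gamma\pi(x)$ for every $x\in X$.
   Context: ${\rm GBC}^-$ is Gödel–Bernays set theory without the power set axiom and with global choice in the form of a class bijection between $V$ and $\mathrm{Ord}$. ${\rm ETR}$ (elementary transfinite recursion) asserts: for every class well-order $\langle\Gamma,\leq_\Gamma\rangle$, every first-order formula $\varphi$ and every class parameter $Z$, there is a class $S\subseteq\Gamma\times V$ with $S_\gamma=\{x\mid\varphi(x,S\restriction\gamma,Z)\}$ for all $\gamma\in\Gamma$, where $S_\gamma=\{x\mid(\gamma,x)\in S\}$ and $S\restriction\gamma=\{(\alpha,x)\in S\mid\alpha<_\Gamma\gamma\}$. A class relation $\vartriangleleft$ on $X$ is well-founded if every nonempty subset of $X$ has a $\vartriangleleft$-minimal element; a class well-order is a well-founded class linear order. A ranking of $\vartriangleleft$ by $\langle\Gamma,\leq_\Gamma\rangle$ is a map $\pi:X\to\Gamma$ with $a\vartriangleleft b\Rightarrow\pi(a)<_\Gamma\pi(b)$; it is continuous if for every $b\in X$, $\pi(b)$ is the $\leq_\Gamma$-least element of $\Gamma$ strictly above $\pi(a)$ for all $a\vartriangleleft b$. *)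

theory Defs
  imports Main
begin

text \<open>
  A model of class theory is given by a type \<open>'a\<close> of sets, a membership relation
  \<open>E\<close> on it (\<open>E x y\<close> means that \<open>x\<close> is an element of \<open>y\<close>), and a collection
  \<open>K\<close> of classes. By class extensionality a class is identified with the HOL set of
  its elements. \<open>K\<close> need not contain all HOL sets, so these are arbitrary (Henkin)
  models of the first-order, two-sorted theory.
\<close>

type_synonym 'a mem = "'a \<Rightarrow> 'a \<Rightarrow> bool"

section \<open>First-order formulas with class parameters\<close>

text \<open>
  Set variables and class variables are numbered separately. Only set variables
  can be quantified.
\<close>

datatype fm =
    MemF nat nat
  | EqF nat nat
  | InClassF nat nat
  | NotF fm
  | AndF fm fm
  | AllF nat fm

primrec sat :: "'a mem \<Rightarrow> (nat \<Rightarrow> 'a set) \<Rightarrow> (nat \<Rightarrow> 'a) \<Rightarrow> fm \<Rightarrow> bool" where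
  "sat E C s (MemF i j) \<longleftrightarrow> E (s i) (s j)"
| "sat E C s (EqF i j) \<longleftrightarrow> s i = s j"
| "sat E C s (InClassF i k) \<longleftrightarrow> s i \<in> C k"
| "sat E C s (NotF \<phi>) \<longleftrightarrow> \<not> sat E C s \<phi>"
| "sat E C s (AndF \<phi> \<psi>) \<longleftrightarrow> sat E C s \<phi> \<and> sat E C s \<psi>"
| "sat E C s (AllF i \<phi>) \<longleftrightarrow> (\<forall>x. sat E C (s(i := x)) \<phi>)"

section \<open>Pairs, class relations and class functions\<close>

definition is_upair :: "'a mem \<Rightarrow> 'a \<Rightarrow> 'a \<Rightarrow> 'a \<Rightarrow> bool" where
  "is_upair E p a b \<longleftrightarrow> (\<forall>z. E z p \<longleftrightarrow> z = a \<or> z = b)"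

text \<open>Kuratowski pairs: \<open>p\<close> is \<open>{{a}, {a, b}}\<close> in the sense of \<open>E\<close>.\<close>

definition is_opair :: "'a mem \<Rightarrow> 'a \<Rightarrow> 'a \<Rightarrow> 'a \<Rightarrow> bool" where
  "is_opair E p a b \<longleftrightarrow> (\<exists>u v. is_upair E u a a \<and> is_upair E v a b \<and> is_upair E p u v)"

definition cprod :: "'a mem \<Rightarrow> 'a set \<Rightarrow> 'a set \<Rightarrow> 'a set" where
  "cprod E X Y = {p. \<exists>a\<in>X. \<exists>b\<in>Y. is_opair E p a b}"

text \<open>The HOL relation coded by a class of internal ordered pairs.\<close>

definition rel :: "'a mem \<Rightarrow> 'a set \<Rightarrow> 'a rel" where
  "rel E R = {(a, b). \<exists>p\<in>R. is_opair E p a b}"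

definition class_rel :: "'a mem \<Rightarrow> 'a set set \<Rightarrow> 'a set \<Rightarrow> 'a set \<Rightarrow> bool" where
  "class_rel E K X R \<longleftrightarrow> X \<in> K \<and> R \<in> K \<and> R \<subseteq> cprod E X X"

definition class_fun :: "'a mem \<Rightarrow> 'a set set \<Rightarrow> 'a set \<Rightarrow> 'a set \<Rightarrow> 'a set \<Rightarrow> bool" where
  "class_fun E K F X Y \<longleftrightarrow>
     F \<in> K \<and> F \<subseteq> cprod E X Y \<and> (\<forall>x\<in>X. \<exists>!y. (x, y) \<in> rel E F)"

definition app :: "'a mem \<Rightarrow> 'a set \<Rightarrow> 'a \<Rightarrow> 'a" where
  "app E F x = (THE y. (x, y) \<in> rel E F)"

section \<open>Goedel--Bernays set theory without power set, with global choice\<close>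

definition transitive :: "'a mem \<Rightarrow> 'a \<Rightarrow> bool" where
  "transitive E x \<longleftrightarrow> (\<forall>y z. E y x \<longrightarrow> E z y \<longrightarrow> E z x)"

text \<open>
  A transitive set linearly ordered by membership; in the presence of the axiom of
  foundation the order is then a strict well-order.
\<close>

definition Ords :: "'a mem \<Rightarrow> 'a set" where
  "Ords E = {x. transitive E x \<and>
     (\<forall>y z. E y x \<longrightarrow> E z x \<longrightarrow> E y z \<or> y = z \<or> E z y)}"

definition extensionality :: "'a mem \<Rightarrow> bool" where
  "extensionality E \<longleftrightarrow> (\<forall>x y. (\<forall>z. E z x \<longleftrightarrow> E z y) \<longrightarrow> x = y)"

definition foundation :: "'a mem \<Rightarrow> bool" where
  "foundation E \<longleftrightarrow> (\<forall>x. (\<exists>y. E y x) \<longrightarrow> (\<exists>y. E y x \<and> \<not> (\<exists>z. E z x \<and> E z y)))"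

definition pairing :: "'a mem \<Rightarrow> bool" where
  "pairing E \<longleftrightarrow> (\<forall>a b. \<exists>p. is_upair E p a b)"

definition union :: "'a mem \<Rightarrow> bool" where
  "union E \<longleftrightarrow> (\<forall>x. \<exists>u. \<forall>z. E z u \<longleftrightarrow> (\<exists>y. E y x \<and> E z y))"

definition infinity :: "'a mem \<Rightarrow> bool" where
  "infinity E \<longleftrightarrow> (\<exists>w. (\<exists>e. E e w \<and> (\<forall>z. \<not> E z e)) \<and>
     (\<forall>x. E x w \<longrightarrow> (\<exists>y. E y w \<and> (\<forall>z. E z y \<longleftrightarrow> E z x \<or> z = x))))"

text \<open>
  Replacement for partial class functions, so that it includes separation. Collection
  follows from it by global choice.
\<close>

definition replacement :: "'a mem \<Rightarrow> 'a set set \<Rightarrow> bool" where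
  "replacement E K \<longleftrightarrow> (\<forall>F\<in>K. single_valued (rel E F) \<longrightarrow>
     (\<forall>a. \<exists>b. \<forall>y. E y b \<longleftrightarrow> (\<exists>x. E x a \<and> (x, y) \<in> rel E F)))"

definition comprehension :: "'a mem \<Rightarrow> 'a set set \<Rightarrow> bool" where
  "comprehension E K \<longleftrightarrow>
     (\<forall>\<phi> C s. range C \<subseteq> K \<longrightarrow> {x. sat E C (s(0 := x)) \<phi>} \<in> K)"

definition global_choice :: "'a mem \<Rightarrow> 'a set set \<Rightarrow> bool" where
  "global_choice E K \<longleftrightarrow>
     (\<exists>F. class_fun E K F UNIV (Ords E) \<and> bij_betw (app E F) UNIV (Ords E))"

definition GBC_minus :: "'a mem \<Rightarrow> 'a set set \<Rightarrow> bool" where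
  "GBC_minus E K \<longleftrightarrow>
     extensionality E \<and> foundation E \<and> pairing E \<and> union E \<and> infinity E \<and>
     replacement E K \<and> comprehension E K \<and> global_choice E K"

section \<open>Well-founded class relations and class well-orders\<close>

text \<open>The quantifier over nonempty subsets ranges over the sets of the model.\<close>

definition well_founded_on :: "'a mem \<Rightarrow> 'a set \<Rightarrow> 'a rel \<Rightarrow> bool" where
  "well_founded_on E X r \<longleftrightarrow>
     (\<forall>s. (\<forall>x. E x s \<longrightarrow> x \<in> X) \<longrightarrow> (\<exists>x. E x s) \<longrightarrow>
        (\<exists>m. E m s \<and> (\<forall>a. E a s \<longrightarrow> (a, m) \<notin> r)))"

definition wf_class_rel :: "'a mem \<Rightarrow> 'a set set \<Rightarrow> 'a set \<Rightarrow> 'a set \<Rightarrow> bool" where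
  "wf_class_rel E K X R \<longleftrightarrow>
     class_rel E K X R \<and> well_founded_on E X (rel E R)"

definition strict :: "'a mem \<Rightarrow> 'a set \<Rightarrow> 'a rel" where
  "strict E L = rel E L - Id"

definition class_well_order :: "'a mem \<Rightarrow> 'a set set \<Rightarrow> 'a set \<Rightarrow> 'a set \<Rightarrow> bool" where
  "class_well_order E K \<Gamma> L \<longleftrightarrow>
     class_rel E K \<Gamma> L \<and> linear_order_on \<Gamma> (rel E L) \<and> well_founded_on E \<Gamma> (strict E L)"

section \<open>Elementary transfinite recursion\<close>

definition restr :: "'a mem \<Rightarrow> 'a set \<Rightarrow> 'a set \<Rightarrow> 'a \<Rightarrow> 'a set" where
  "restr E L S \<gamma> = {p \<in> S. \<exists>\<alpha> x. is_opair E p \<alpha> x \<and> (\<alpha>, \<gamma>) \<in> strict E L}"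

text \<open>
  The formula \<open>\<phi>(x, A, Z)\<close> has one set argument and two class arguments. Accordingly
  all free set variables of \<open>\<phi>\<close> are interpreted as \<open>x\<close>, the class variable \<open>0\<close>
  as \<open>A\<close>, and the other class variables as \<open>Z\<close>; no further parameters occur.
\<close>

definition ETR :: "'a mem \<Rightarrow> 'a set set \<Rightarrow> bool" where
  "ETR E K \<longleftrightarrow>
     (\<forall>\<Gamma> L \<phi> Z. class_well_order E K \<Gamma> L \<longrightarrow> Z \<in> K \<longrightarrow>
        (\<exists>S\<in>K. S \<subseteq> cprod E \<Gamma> UNIV \<and>
           (\<forall>\<gamma>\<in>\<Gamma>. {x. (\<gamma>, x) \<in> rel E S} =
              {x. sat E (\<lambda>k. if k = 0 then restr E L S \<gamma> else Z) (\<lambda>_. x) \<phi>})))"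

section \<open>Rankings\<close>

definition ranking ::
    "'a mem \<Rightarrow> 'a set set \<Rightarrow> 'a set \<Rightarrow> 'a set \<Rightarrow> 'a set \<Rightarrow> 'a set \<Rightarrow> 'a set \<Rightarrow> bool" where
  "ranking E K X R \<Gamma> L \<pi> \<longleftrightarrow>
     class_fun E K \<pi> X \<Gamma> \<and>
     (\<forall>a b. (a, b) \<in> rel E R \<longrightarrow> (app E \<pi> a, app E \<pi> b) \<in> strict E L)"

definition continuous_ranking ::
    "'a mem \<Rightarrow> 'a set set \<Rightarrow> 'a set \<Rightarrow> 'a set \<Rightarrow> 'a set \<Rightarrow> 'a set \<Rightarrow> 'a set \<Rightarrow> bool" where
  "continuous_ranking E K X R \<Gamma> L \<pi> \<longleftrightarrow>
     ranking E K X R \<Gamma> L \<pi> \<and>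
     (\<forall>b\<in>X. \<forall>\<gamma>\<in>\<Gamma>. (\<forall>a. (a, b) \<in> rel E R \<longrightarrow> (app E \<pi> a, \<gamma>) \<in> strict E L) \<longrightarrow>
        (app E \<pi> b, \<gamma>) \<in> rel E L)"

end

theory Submission
  imports Defs
begin

text \<open>
  Given a class well-order \<open>\<Gamma>\<close>, a recursion along \<open>\<Gamma>\<close> puts a point into stage \<open>\<gamma>\<close>
  as soon as all its predecessors lie in stages before \<open>\<gamma>\<close>; the least stage of a point is
  then a continuous rank. Every point is reached, and no later than its value under a given
  ranking, because a least failure would yield an earlier one. Least elements of
  classes, not only of sets, come from a descending sequence indexed by the finite ordinals.

  For an arbitrary well-founded relation, \<open>\<Gamma>\<close> is the class of descending sequences with
  their Kleene--Brouwer order. A point need not be mapped to a single sequence: it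
  suffices that each sequence ending in \<open>x\<close> can be extended by any predecessor of \<open>x\<close> and
  thereby decreases, so that the same recursion reaches \<open>x\<close> by the stage of any sequence
  ending in \<open>x\<close>.
\<close>

section \<open>Definability\<close>

text \<open>The obstacle is that every minimality principle is internal. \<open>E\<close> need not
  be well-founded in HOL and \<open>K\<close> need not contain every HOL set, so a least
  counterexample is available only once the counterexamples are shown to form a first-order
  definable class; \<open>definable\<close> exists for this. Moreover \<open>well_founded_on\<close>
  tests sets of the model, whereas the failures of a recursion form a class. Bridging this gap
  already takes a recursion along the ordinals.

  Recursion along the given relation itself is not on offer, since \<open>ETR\<close> recurs along
  class well-orders; hence a well-order has to be manufactured from the relation. The
  Kleene--Brouwer order fits because passing to a predecessor extends a sequence and so decreases
  it, while comparing entries by the global well-order makes the order linear.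

  \<open>ETR\<close> also admits a single class parameter and no set parameter, so all data of a
  recursion must be coded into one class.\<close>

primrec fm_vars :: "fm \<Rightarrow> nat set" where
  "fm_vars (MemF i j) = {i, j}"
| "fm_vars (EqF i j) = {i, j}"
| "fm_vars (InClassF i k) = {i}"
| "fm_vars (NotF \<phi>) = fm_vars \<phi>"
| "fm_vars (AndF \<phi> \<psi>) = fm_vars \<phi> \<union> fm_vars \<psi>"
| "fm_vars (AllF i \<phi>) = insert i (fm_vars \<phi>)"

lemma finite_fm_vars: "finite (fm_vars \<phi>)"
  by (induction \<phi>) auto

lemma sat_cong: "(\<And>i. i \<in> fm_vars \<phi> \<Longrightarrow> s i = t i) \<Longrightarrow> sat E C s \<phi> \<longleftrightarrow> sat E C t \<phi>"
proof (induction \<phi> arbitrary: s t)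
  case (AllF i \<phi>)
  have "sat E C (s(i := x)) \<phi> \<longleftrightarrow> sat E C (t(i := x)) \<phi>" for x
    by (rule AllF.IH) (use AllF.prems in auto)
  then show ?case by simp
next
  case (NotF \<phi>)
  then show ?case by (metis fm_vars.simps(4) sat.simps(4))
next
  case (AndF \<phi> \<psi>)
  then show ?case by (metis UnCI fm_vars.simps(5) sat.simps(5))
qed auto

lemma exists_renamed_fm:
  "\<exists>\<psi>. \<forall>s. sat E C s \<psi> \<longleftrightarrow> sat E C (s \<circ> f) \<phi>"
proof (induction \<phi> arbitrary: f)
  case (MemF i j)
  show ?case by (rule exI[of _ "MemF (f i) (f j)"]) simp
next
  case (EqF i j)
  show ?case by (rule exI[of _ "EqF (f i) (f j)"]) simp
next
  case (InClassF i k)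
  show ?case by (rule exI[of _ "InClassF (f i) k"]) simp
next
  case (NotF \<phi>)
  then show ?case by (metis sat.simps(4))
next
  case (AndF \<phi> \<psi>)
  then show ?case by (metis sat.simps(5))
next
  case (AllF i \<phi>)
  \<comment> \<open>\<open>f\<close> need not be injective, so the bound variable is moved outside
    the image of all variables to avoid capture.\<close>
  obtain m where m: "m \<notin> f ` fm_vars \<phi>"
    using ex_new_if_finite[OF infinite_UNIV_nat] finite_fm_vars by blast
  obtain \<psi> where \<psi>: "\<And>s. sat E C s \<psi> \<longleftrightarrow> sat E C (s \<circ> f(i := m)) \<phi>"
    using AllF.IH by blast
  have "sat E C (s(m := x) \<circ> f(i := m)) \<phi> \<longleftrightarrow> sat E C ((s \<circ> f)(i := x)) \<phi>" for s x
    by (rule sat_cong) (use m in auto)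
  then have "\<forall>s. sat E C s (AllF m \<psi>) \<longleftrightarrow> sat E C (s \<circ> f) (AllF i \<phi>)"
    using \<psi> by simp
  then show ?case by blast
qed

text \<open>Class variables are never quantified, so renaming them cannot cause capture. It serves
  to keep the parameters of two formulas apart.\<close>

primrec rename_classes :: "(nat \<Rightarrow> nat) \<Rightarrow> fm \<Rightarrow> fm" where
  "rename_classes g (MemF i j) = MemF i j"
| "rename_classes g (EqF i j) = EqF i j"
| "rename_classes g (InClassF i k) = InClassF i (g k)"
| "rename_classes g (NotF \<phi>) = NotF (rename_classes g \<phi>)"
| "rename_classes g (AndF \<phi> \<psi>) = AndF (rename_classes g \<phi>) (rename_classes g \<psi>)"
| "rename_classes g (AllF i \<phi>) = AllF i (rename_classes g \<phi>)"

lemma sat_rename_classes: "sat E C s (rename_classes g \<phi>) \<longleftrightarrow> sat E (C \<circ> g) s \<phi>"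
  by (induction \<phi> arbitrary: s) auto

text \<open>Hiding the formula and its class parameters turns definability into closure rules that
  need no syntax. Neither may depend on \<open>s\<close>.\<close>

definition definable :: "'a mem \<Rightarrow> 'a set set \<Rightarrow> ((nat \<Rightarrow> 'a) \<Rightarrow> bool) \<Rightarrow> bool" where
  "definable E K P \<longleftrightarrow> (\<exists>\<phi> C. range C \<subseteq> K \<and> (\<forall>s. sat E C s \<phi> \<longleftrightarrow> P s))"

definition simple_term :: "((nat \<Rightarrow> 'a) \<Rightarrow> 'a) \<Rightarrow> bool" where
  "simple_term \<tau> \<longleftrightarrow> (\<exists>i. \<tau> = (\<lambda>s. s i)) \<or> (\<exists>c. \<tau> = (\<lambda>s. c))"

lemma simple_term_var: "simple_term (\<lambda>s. s i)"
  unfolding simple_term_def by blast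

lemma simple_term_const: "simple_term (\<lambda>s. c)"
  unfolding simple_term_def by blast

lemma simple_term_lift: "simple_term \<tau> \<Longrightarrow> simple_term (\<lambda>s. \<tau> (\<lambda>n. s (Suc n)))"
  unfolding simple_term_def by auto

definition represented :: "'a mem \<Rightarrow> 'a set \<Rightarrow> bool" where
  "represented E A \<longleftrightarrow> (\<exists>b. \<forall>x. E x b \<longleftrightarrow> x \<in> A)"

definition maps :: "'a mem \<Rightarrow> 'a \<Rightarrow> 'a \<Rightarrow> 'a \<Rightarrow> bool" where
  "maps E t b a \<longleftrightarrow> (\<exists>p. E p t \<and> is_opair E p b a)"

definition is_succ :: "'a mem \<Rightarrow> 'a \<Rightarrow> 'a \<Rightarrow> bool" where
  "is_succ E z x \<longleftrightarrow> (\<forall>y. E y z \<longleftrightarrow> E y x \<or> y = x)"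

lemma in_rel_iff: "(a, b) \<in> rel E R \<longleftrightarrow> (\<exists>p. p \<in> R \<and> is_opair E p a b)"
  unfolding rel_def by auto

lemma in_strict_iff: "(a, b) \<in> strict E L \<longleftrightarrow> (a, b) \<in> rel E L \<and> a \<noteq> b"
  unfolding strict_def by auto

locale GBC =
  fixes E :: "'a mem" and K :: "'a set set"
  assumes GBC_minus: "GBC_minus E K"
begin

abbreviation "fo \<equiv> definable E K"

lemma extensionality: "(\<And>z. E z x \<longleftrightarrow> E z y) \<Longrightarrow> x = y"
  using GBC_minus unfolding GBC_minus_def extensionality_def by blast

lemma ex_upair: "\<exists>p. is_upair E p a b"
  using GBC_minus unfolding GBC_minus_def pairing_def by blast

lemma classes_nonempty: "K \<noteq> {}"
  using GBC_minus unfolding GBC_minus_def global_choice_def class_fun_def by blast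

lemma definable_class: "fo P \<Longrightarrow> {x. P (s(0 := x))} \<in> K"
  using GBC_minus unfolding GBC_minus_def comprehension_def definable_def
  by (metis (mono_tags, lifting) Collect_cong)

lemma class_Collect: "fo (\<lambda>s. P (s 0)) \<Longrightarrow> {x. P x} \<in> K"
  using definable_class[of "\<lambda>s. P (s 0)"] by simp

lemma definable_rename: "fo P \<Longrightarrow> fo (\<lambda>s. P (s \<circ> f))"
  unfolding definable_def by (metis exists_renamed_fm)

lemma definable_not: "fo P \<Longrightarrow> fo (\<lambda>s. \<not> P s)"
  unfolding definable_def by (metis sat.simps(4))

lemma definable_and:
  assumes "fo P" "fo Q"
  shows "fo (\<lambda>s. P s \<and> Q s)"
proof -
  obtain \<phi> C \<psi> D where
    C: "range C \<subseteq> K" "\<And>s. sat E C s \<phi> \<longleftrightarrow> P s" and D: "range D \<subseteq> K" "\<And>s. sat E D s \<psi> \<longleftrightarrow> Q s"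
    using assms unfolding definable_def by metis
  \<comment> \<open>Each formula has its own parameter sequence; even indices carry
    \<open>C\<close>, odd ones \<open>D\<close>.\<close>
  define B where "B = (\<lambda>k. if even k then C (k div 2) else D (k div 2))"
  have "B \<circ> (\<lambda>k. 2 * k) = C" "B \<circ> (\<lambda>k. Suc (2 * k)) = D"
    unfolding B_def by auto
  then have "sat E B s (AndF (rename_classes (\<lambda>k. 2 * k) \<phi>) (rename_classes (\<lambda>k. Suc (2 * k)) \<psi>))
      \<longleftrightarrow> P s \<and> Q s" for s
    by (simp add: sat_rename_classes C D)
  moreover have "range B \<subseteq> K"
    using C(1) D(1) unfolding B_def by auto
  ultimately show ?thesis
    unfolding definable_def by blast
qed

text \<open>
  The bound variable is the variable \<open>0\<close>, in the style of de Bruijn, so that no freshness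
  condition arises and the rule applies by higher-order pattern unification.
\<close>

lemma definable_all:
  assumes "fo (\<lambda>s. Q (s 0) (\<lambda>n. s (Suc n)))"
  shows "fo (\<lambda>s. \<forall>x. Q x s)"
proof -
  obtain \<phi> C where C: "range C \<subseteq> K" and \<phi>: "\<And>s. sat E C s \<phi> \<longleftrightarrow> Q (s 0) (\<lambda>n. s (Suc n))"
    using assms unfolding definable_def by blast
  \<comment> \<open>In \<open>\<phi>\<close> the variable \<open>0\<close> is the quantified one and
    \<open>Suc n\<close> stands for \<open>n\<close>. Renaming by \<open>case_nat m id\<close>
    undoes the shift, and an \<open>m\<close> above all variables clashes with none.\<close>
  obtain m where m: "\<And>i. i \<in> fm_vars \<phi> \<Longrightarrow> i < m"
    using finite_fm_vars[of \<phi>] by (metis finite_nat_set_iff_bounded)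
  obtain \<psi> where \<psi>: "\<And>s. sat E C s \<psi> \<longleftrightarrow> sat E C (s \<circ> case_nat m id) \<phi>"
    using exists_renamed_fm by blast
  have "sat E C (s(m := x) \<circ> case_nat m id) \<phi> \<longleftrightarrow> sat E C (case_nat x s) \<phi>" for s x
    by (rule sat_cong) (auto split: nat.split dest: m)
  then have "sat E C s (AllF m \<psi>) \<longleftrightarrow> (\<forall>x. Q x s)" for s
    by (simp add: \<psi> \<phi>)
  with C show ?thesis
    unfolding definable_def by blast
qed

lemma definable_or:
  assumes "fo P" "fo Q"
  shows "fo (\<lambda>s. P s \<or> Q s)"
proof -
  have "fo (\<lambda>s. \<not> (\<not> P s \<and> \<not> Q s))"
    by (rule definable_not, rule definable_and) (rule definable_not, rule assms)+
  then show ?thesis by simp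
qed

lemma definable_imp:
  assumes "fo P" "fo Q"
  shows "fo (\<lambda>s. P s \<longrightarrow> Q s)"
  unfolding imp_conv_disj
  by (rule definable_or[OF definable_not]) (rule assms)+

lemma definable_iff:
  assumes "fo P" "fo Q"
  shows "fo (\<lambda>s. P s = Q s)"
  unfolding iff_conv_conj_imp
  by (rule definable_and; rule definable_imp) (rule assms)+

lemma definable_ex:
  assumes "fo (\<lambda>s. Q (s 0) (\<lambda>n. s (Suc n)))"
  shows "fo (\<lambda>s. \<exists>x. Q x s)"
proof -
  have "fo (\<lambda>s. \<not> (\<forall>x. \<not> Q x s))"
    by (rule definable_not, rule definable_all, rule definable_not, rule assms)
  then show ?thesis by simp
qed

lemma definable_mem_var: "fo (\<lambda>s. E (s i) (s j))"
  unfolding definable_def using classes_nonempty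
  by (intro exI[of _ "MemF i j"] exI[of _ "\<lambda>_. SOME A. A \<in> K"]) (auto simp: some_in_eq)

lemma definable_eq_var: "fo (\<lambda>s. s i = s j)"
  unfolding definable_def using classes_nonempty
  by (intro exI[of _ "EqF i j"] exI[of _ "\<lambda>_. SOME A. A \<in> K"]) (auto simp: some_in_eq)

lemma definable_in_var: "A \<in> K \<Longrightarrow> fo (\<lambda>s. s i \<in> A)"
  unfolding definable_def
  by (intro exI[of _ "InClassF i 0"] exI[of _ "\<lambda>_. A"]) auto

lemma singleton_class: "{c} \<in> K"
  using definable_class[OF definable_eq_var[of 0 1], of "\<lambda>_. c"] by simp

text \<open>A fixed set may occur in a definition because it is the only element of the class
  \<open>{c}\<close>: a quantifier bounded by that class replaces it.\<close>

lemma definable_subst_const: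
  assumes "fo (\<lambda>s. Q (s 0) (\<lambda>n. s (Suc n)))"
  shows "fo (\<lambda>s. Q c s)"
proof -
  have "fo (\<lambda>s. \<exists>x. x \<in> {c} \<and> Q x s)"
    by (intro definable_ex definable_and definable_in_var singleton_class assms)
  then show ?thesis by simp
qed

lemma definable_in:
  assumes "simple_term \<tau>" "A \<in> K"
  shows "fo (\<lambda>s. \<tau> s \<in> A)"
  using assms definable_subst_const[of "\<lambda>x s. x \<in> A"]
  unfolding simple_term_def by (auto intro: definable_in_var)

lemma definable_mem:
  assumes "simple_term \<tau>" "simple_term \<sigma>"
  shows "fo (\<lambda>s. E (\<tau> s) (\<sigma> s))"
proof -
  have 1: "fo (\<lambda>s. E (s i) c)" for i c
    using definable_subst_const[of "\<lambda>x s. E (s i) x" c] by (simp add: definable_mem_var)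
  have 2: "fo (\<lambda>s. E c (s i))" for i c
    using definable_subst_const[of "\<lambda>x s. E x (s i)" c] by (simp add: definable_mem_var)
  have 3: "fo (\<lambda>s. E c d)" for c d
    using definable_subst_const[of "\<lambda>x s. E x d" c] by (simp add: 1)
  show ?thesis
    using assms 1 2 3 unfolding simple_term_def by (auto intro: definable_mem_var)
qed

text \<open>Extensionality trades equality for membership, where constants have already been dealt
  with.\<close>

lemma definable_eq:
  assumes "simple_term \<tau>" "simple_term \<sigma>"
  shows "fo (\<lambda>s. \<tau> s = \<sigma> s)"
proof -
  have "fo (\<lambda>s. \<forall>z. E z (\<tau> s) = E z (\<sigma> s))"
    by (intro definable_all definable_iff definable_mem simple_term_var assms[THEN simple_term_lift])
  then show ?thesis
    by (rule back_subst[of fo]) (auto intro!: ext extensionality)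
qed

lemma definable_Ball:
  assumes "A \<in> K" "fo (\<lambda>s. Q (s 0) (\<lambda>n. s (Suc n)))"
  shows "fo (\<lambda>s. \<forall>x\<in>A. Q x s)"
  unfolding Ball_def by (intro definable_all definable_imp definable_in_var assms)

lemma definable_Bex:
  assumes "A \<in> K" "fo (\<lambda>s. Q (s 0) (\<lambda>n. s (Suc n)))"
  shows "fo (\<lambda>s. \<exists>x\<in>A. Q x s)"
  unfolding Bex_def by (intro definable_ex definable_and definable_in_var assms)

lemmas definable_base = definable_all definable_ex definable_and definable_or definable_imp
  definable_not definable_iff definable_mem definable_eq definable_in definable_Ball definable_Bex
  simple_term_var

lemma definable_opair:
  assumes "simple_term \<rho>" "simple_term \<tau>" "simple_term \<sigma>"
  shows "fo (\<lambda>s. is_opair E (\<rho> s) (\<tau> s) (\<sigma> s))"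
  unfolding is_opair_def is_upair_def
  by (intro definable_base assms[THEN simple_term_lift, THEN simple_term_lift]
      assms[THEN simple_term_lift, THEN simple_term_lift, THEN simple_term_lift])

lemma definable_rel:
  assumes "R \<in> K" "simple_term \<tau>" "simple_term \<sigma>"
  shows "fo (\<lambda>s. (\<tau> s, \<sigma> s) \<in> rel E R)"
  unfolding in_rel_iff
  by (intro definable_base definable_opair assms(1) assms(2,3)[THEN simple_term_lift])

lemma definable_strict:
  assumes "L \<in> K" "simple_term \<tau>" "simple_term \<sigma>"
  shows "fo (\<lambda>s. (\<tau> s, \<sigma> s) \<in> strict E L)"
  unfolding in_strict_iff
  by (intro definable_base definable_rel assms)

lemma definable_maps:
  assumes "simple_term \<rho>" "simple_term \<tau>" "simple_term \<sigma>"
  shows "fo (\<lambda>s. maps E (\<rho> s) (\<tau> s) (\<sigma> s))"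
  unfolding maps_def
  by (intro definable_base definable_opair assms[THEN simple_term_lift])

lemma definable_succ:
  assumes "simple_term \<tau>" "simple_term \<sigma>"
  shows "fo (\<lambda>s. is_succ E (\<tau> s) (\<sigma> s))"
  unfolding is_succ_def
  by (intro definable_base assms[THEN simple_term_lift])

lemma Ords_class: "Ords E \<in> K"
  unfolding Ords_def transitive_def
  by (rule class_Collect) (intro definable_base)

lemmas definable_intros = definable_base definable_opair definable_rel definable_strict
  definable_maps definable_succ simple_term_const Ords_class

section \<open>Sets and ordered pairs\<close>

lemma ex_opair: "\<exists>p. is_opair E p a b"
  unfolding is_opair_def by (meson ex_upair)

lemma upair_unique: "is_upair E p a b \<Longrightarrow> is_upair E q a b \<Longrightarrow> p = q"
  unfolding is_upair_def by (rule extensionality) simp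

lemma opair_unique: "is_opair E p a b \<Longrightarrow> is_opair E q a b \<Longrightarrow> p = q"
  unfolding is_opair_def by (metis upair_unique)

lemma opair_inject:
  assumes "is_opair E p a b" "is_opair E p c d"
  shows "a = c \<and> b = d"
proof -
  obtain u v where u: "is_upair E u a a" and v: "is_upair E v a b" and p: "is_upair E p u v"
    using assms(1) unfolding is_opair_def by blast
  obtain u' v' where u': "is_upair E u' c c" and v': "is_upair E v' c d" and p': "is_upair E p u' v'"
    using assms(2) unfolding is_opair_def by blast
  have "u = u' \<or> u = v'" "v = u' \<or> v = v'" "u' = u \<or> u' = v" "v' = u \<or> v' = v"
    using p p' unfolding is_upair_def by metis+
  then show ?thesis
    using u v u' v' unfolding is_upair_def by metis
qed

lemma rel_Collect_pairs: "(a, b) \<in> rel E {p. \<exists>x y. is_opair E p x y \<and> P x y} \<longleftrightarrow> P a b"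
  unfolding in_rel_iff using ex_opair opair_inject by blast

lemma class_Collect_pairs:
  assumes "fo (\<lambda>s. P (s 0) (s 1))"
  shows "{p. \<exists>x y. is_opair E p x y \<and> P x y} \<in> K"
proof (rule class_Collect, intro definable_ex definable_and definable_opair simple_term_var)
  \<comment> \<open>The inner variable \<open>y\<close> has index \<open>0\<close>, so the arguments
    come out in reverse; \<open>1 - i\<close> exchanges \<open>0\<close> and
    \<open>1\<close>.\<close>
  show "fo (\<lambda>s. P (s (Suc 0)) (s 0))"
    using definable_rename[OF assms, of "\<lambda>i. 1 - i"] by simp
qed

lemma cprod_iff: "is_opair E p a b \<Longrightarrow> p \<in> cprod E X Y \<longleftrightarrow> a \<in> X \<and> b \<in> Y"
  unfolding cprod_def using opair_inject by blast

lemma rel_cprodD: "F \<subseteq> cprod E X Y \<Longrightarrow> (a, b) \<in> rel E F \<Longrightarrow> a \<in> X \<and> b \<in> Y"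
  unfolding in_rel_iff using cprod_iff by blast

lemma app_eq_iff:
  assumes "class_fun E K F X Y" "x \<in> X"
  shows "app E F x = y \<longleftrightarrow> (x, y) \<in> rel E F"
proof -
  have "\<exists>!y. (x, y) \<in> rel E F"
    using assms unfolding class_fun_def by blast
  then show ?thesis
    unfolding app_def by (metis theI')
qed

lemma app_in:
  assumes "class_fun E K F X Y" "x \<in> X"
  shows "app E F x \<in> Y"
  using app_eq_iff[OF assms] assms(1) rel_cprodD unfolding class_fun_def by metis

lemma represented_Collect: "represented E {x. P x} \<longleftrightarrow> (\<exists>b. \<forall>x. E x b \<longleftrightarrow> P x)"
  unfolding represented_def by simp

lemma represented_members: "represented E {x. E x b}"
  unfolding represented_def by blast

lemma represented_Union: "represented E {z. \<exists>y. E y x \<and> E z y}"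
  using GBC_minus unfolding GBC_minus_def union_def represented_Collect by blast

lemma represented_image:
  assumes "fo (\<lambda>s. P (s 0) (s 1))" "\<And>x y y'. P x y \<Longrightarrow> P x y' \<Longrightarrow> y = y'"
  shows "represented E {y. \<exists>x. E x a \<and> P x y}"
proof -
  define F where "F = {p. \<exists>x y. is_opair E p x y \<and> P x y}"
  have "F \<in> K"
    unfolding F_def by (rule class_Collect_pairs[OF assms(1)])
  moreover have F: "(x, y) \<in> rel E F \<longleftrightarrow> P x y" for x y
    unfolding F_def by (rule rel_Collect_pairs)
  moreover have "single_valued (rel E F)"
    using assms(2) unfolding single_valued_def F by blast
  ultimately have "\<exists>b. \<forall>y. E y b \<longleftrightarrow> (\<exists>x. E x a \<and> (x, y) \<in> rel E F)"
    using GBC_minus unfolding GBC_minus_def replacement_def by metis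
  then show ?thesis
    unfolding represented_Collect F .
qed

text \<open>Replacement collects the sets that code the sections \<open>{y. P x y}\<close>, and the
  union axiom merges them.\<close>

lemma represented_UN:
  assumes "fo (\<lambda>s. P (s 0) (s 1))" "\<And>x. E x a \<Longrightarrow> represented E {y. P x y}"
  shows "represented E {y. \<exists>x. E x a \<and> P x y}"
proof -
  have fo: "fo (\<lambda>s. \<forall>y. E y (s 1) = P (s 0) y)"
  proof (intro definable_all definable_iff definable_mem simple_term_var)
    show "fo (\<lambda>s. P (s (Suc 0)) (s 0))"
      using definable_rename[OF assms(1), of "\<lambda>i. 1 - i"] by simp
  qed
  have "represented E {z. \<exists>x. E x a \<and> (\<forall>y. E y z \<longleftrightarrow> P x y)}"
    by (rule represented_image[OF fo]) (auto intro: extensionality)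
  then obtain b where b: "\<And>z. E z b \<longleftrightarrow> (\<exists>x. E x a \<and> (\<forall>y. E y z \<longleftrightarrow> P x y))"
    unfolding represented_Collect by blast
  have "{y. \<exists>z. E z b \<and> E y z} = {y. \<exists>x. E x a \<and> P x y}"
    using assms(2) unfolding b represented_Collect by auto (metis)
  then show ?thesis
    using represented_Union[of b] by simp
qed

lemma represented_empty: "represented E {}"
  using GBC_minus unfolding GBC_minus_def infinity_def represented_def by blast

lemma represented_insert:
  assumes "represented E A"
  shows "represented E (insert x A)"
proof -
  obtain a u v where "\<And>z. E z a \<longleftrightarrow> z \<in> A" and "is_upair E u x x" and "is_upair E v u a"
    using assms ex_upair unfolding represented_def by metis
  then have "{z. \<exists>y. E y v \<and> E z y} = insert x A"
    unfolding is_upair_def by auto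
  then show ?thesis
    using represented_Union[of v] by simp
qed

lemma represented_finite: "finite A \<Longrightarrow> represented E A"
  by (induction A rule: finite_induct) (auto intro: represented_empty represented_insert)

lemma represented_separation:
  assumes "fo (\<lambda>s. P (s 0))"
  shows "represented E {x. E x a \<and> P x}"
proof -
  have "fo (\<lambda>s. s 0 = s 1 \<and> P (s 0))"
    by (intro definable_intros assms)
  then have "represented E {y. \<exists>x. E x a \<and> x = y \<and> P x}"
    by (rule represented_image) simp
  then show ?thesis
    by (rule back_subst[of "represented E"]) auto
qed

lemma represented_min:
  assumes "represented E A" "A \<noteq> {}"
  shows "\<exists>m\<in>A. \<forall>a\<in>A. \<not> E a m"
  using assms GBC_minus unfolding GBC_minus_def foundation_def represented_def by (metis ex_in_conv)

section \<open>Ordinals and the global well-order\<close>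

text \<open>A cycle would be a finite nonempty set without an \<open>E\<close>-minimal element,
  against foundation.\<close>

lemma
  shows mem_irrefl: "\<not> E x x"
    and mem_asym: "E x y \<Longrightarrow> \<not> E y x"
    and mem_no_3_cycle: "E x y \<Longrightarrow> E y z \<Longrightarrow> \<not> E z x"
proof -
  have "\<exists>m\<in>A. \<forall>a\<in>A. \<not> E a m" if "finite A" "A \<noteq> {}" for A
    using that represented_min represented_finite by blast
  note min = this
  show "\<not> E x x"
    using min[of "{x}"] by simp
  show "E x y \<Longrightarrow> \<not> E y x"
    using min[of "{x, y}"] by auto
  show "E x y \<Longrightarrow> E y z \<Longrightarrow> \<not> E z x"
    using min[of "{x, y, z}"] by auto
qed

lemma Ords_mem_trans: "x \<in> Ords E \<Longrightarrow> E z y \<Longrightarrow> E y x \<Longrightarrow> E z x"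
  unfolding Ords_def transitive_def by blast

lemma Ords_members:
  assumes "x \<in> Ords E" "E y x"
  shows "y \<in> Ords E"
proof -
  have tr: "\<And>u v. E u v \<Longrightarrow> E v x \<Longrightarrow> E u x"
    and lin: "\<And>u v. E u x \<Longrightarrow> E v x \<Longrightarrow> E u v \<or> u = v \<or> E v u"
    using assms(1) unfolding Ords_def transitive_def by blast+
  have "E u y" if vy: "E v y" and uv: "E u v" for u v
  proof -
    have "E v x"
      by (rule tr[OF vy assms(2)])
    then have "E u y \<or> u = y \<or> E y u"
      by (intro lin tr[OF uv] assms(2))
    then show ?thesis
      using mem_asym[OF vy] uv mem_no_3_cycle[OF uv vy] by blast
  qed
  moreover have "E u v \<or> u = v \<or> E v u" if "E u y" "E v y" for u v
    by (intro lin tr[OF _ assms(2)] that)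
  ultimately show ?thesis
    unfolding Ords_def transitive_def by simp
qed

text \<open>Foundation covers sets only, so \<open>Y\<close> is cut down to the members of some
  \<open>y\<close> in it. Transitivity of \<open>y\<close> makes a minimal element of the cut
  minimal in all of \<open>Y\<close>.\<close>

lemma Ords_min:
  assumes "Y \<in> K" "Y \<subseteq> Ords E" "Y \<noteq> {}"
  shows "\<exists>m\<in>Y. \<forall>a\<in>Y. \<not> E a m"
proof -
  obtain y where y: "y \<in> Y"
    using assms(3) by blast
  show ?thesis
  proof (cases "{x. E x y \<and> x \<in> Y} = {}")
    case True
    then show ?thesis using y by blast
  next
    case False
    have "represented E {x. E x y \<and> x \<in> Y}"
      by (rule represented_separation) (intro definable_intros assms(1))
    with False obtain m where "E m y" "m \<in> Y" "\<forall>a. E a y \<and> a \<in> Y \<longrightarrow> \<not> E a m"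
      using represented_min by blast
    moreover have "y \<in> Ords E"
      using y assms(2) by blast
    ultimately show ?thesis
      using Ords_mem_trans by blast
  qed
qed

lemma Ords_least:
  assumes "fo (\<lambda>s. P (s 0))" "x \<in> Ords E" "P x"
  shows "\<exists>m\<in>Ords E. P m \<and> (\<forall>a. E a m \<longrightarrow> \<not> P a)"
proof -
  let ?Y = "{a. a \<in> Ords E \<and> P a}"
  have "?Y \<in> K"
    by (rule class_Collect) (intro definable_intros assms(1))
  moreover have "x \<in> ?Y"
    using assms(2,3) by simp
  ultimately have "\<exists>m\<in>?Y. \<forall>a\<in>?Y. \<not> E a m"
    by (intro Ords_min) auto
  then show ?thesis
    using Ords_members by fast
qed

text \<open>Take a minimal \<open>a\<close> that is incomparable to something, and a minimal
  \<open>b\<close> incomparable to \<open>a\<close>. Minimality gives them the same members, so they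
  are equal and hence comparable.\<close>

lemma Ords_linear:
  assumes "x \<in> Ords E" "y \<in> Ords E"
  shows "E x y \<or> x = y \<or> E y x"
proof (rule ccontr)
  assume *: "\<not> ?thesis"
  let ?inc = "\<lambda>x y. \<not> E x y \<and> x \<noteq> y \<and> \<not> E y x"
  have "{x. x \<in> Ords E \<and> (\<exists>y\<in>Ords E. ?inc x y)} \<in> K"
    by (rule class_Collect) (intro definable_intros)
  from Ords_min[OF this] obtain a where a: "a \<in> Ords E" "\<exists>y\<in>Ords E. ?inc a y"
    and a_min: "\<And>x. x \<in> Ords E \<Longrightarrow> E x a \<Longrightarrow> \<forall>y\<in>Ords E. \<not> ?inc x y"
    using assms * by blast
  have "{y. y \<in> Ords E \<and> ?inc a y} \<in> K"
    by (rule class_Collect) (intro definable_intros)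
  from Ords_min[OF this] obtain b where b: "b \<in> Ords E" "?inc a b"
    and b_min: "\<And>y. y \<in> Ords E \<Longrightarrow> E y b \<Longrightarrow> \<not> ?inc a y"
    using a(2) by blast
  have "E z b" if "E z a" for z
  proof -
    have "\<not> ?inc z b"
      using a_min[OF Ords_members[OF a(1) that] that] b(1) by simp
    moreover have "z \<noteq> b" "\<not> E b z"
      using that b(2) Ords_mem_trans[OF a(1) _ that] by auto
    ultimately show ?thesis by simp
  qed
  moreover have "E z a" if "E z b" for z
  proof -
    have "\<not> ?inc a z"
      using b_min[OF Ords_members[OF b(1) that] that] .
    moreover have "z \<noteq> a" "\<not> E a z"
      using that b(2) Ords_mem_trans[OF b(1) _ that] by auto
    ultimately show ?thesis by auto
  qed
  ultimately have "a = b"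
    by (intro extensionality) blast
  then show False
    using b(2) by simp
qed

lemma ex_succ: "\<exists>z. is_succ E z x"
  using represented_insert[OF represented_members[of x], of x]
  unfolding represented_def is_succ_def by auto

lemma Ords_succ:
  assumes "x \<in> Ords E" "is_succ E z x"
  shows "z \<in> Ords E"
proof -
  have z: "E y z \<longleftrightarrow> E y x \<or> y = x" for y
    using assms(2) unfolding is_succ_def by simp
  have "E u z" if "E y z" "E u y" for u y
    using that Ords_mem_trans[OF assms(1), of u y] unfolding z by blast
  moreover have "E y u \<or> y = u \<or> E u y" if "E y z" "E u z" for u y
    using that Ords_linear[OF Ords_members Ords_members, OF assms(1) _ assms(1), of y u]
    unfolding z by blast
  ultimately show ?thesis
    unfolding Ords_def transitive_def by simp
qed

lemma succ_unique: "is_succ E z x \<Longrightarrow> is_succ E z' x \<Longrightarrow> z = z'"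
  unfolding is_succ_def by (rule extensionality) simp

lemma succ_mem: "is_succ E z x \<Longrightarrow> E x z"
  unfolding is_succ_def by simp

text \<open>Stands in for omega: the set from the axiom of infinity, cut down to ordinals. It may
  contain infinite ordinals too; its uses rely on zero and on closure under successor.\<close>

lemma ex_inductive_Ords:
  "\<exists>A z. represented E A \<and> A \<subseteq> Ords E \<and> z \<in> A \<and> (\<forall>x. \<not> E x z) \<and>
    (\<forall>x\<in>A. \<forall>y. is_succ E y x \<longrightarrow> y \<in> A)"
proof -
  obtain w z where z: "E z w" "\<And>x. \<not> E x z"
    and w: "\<And>x. E x w \<Longrightarrow> \<exists>y. E y w \<and> is_succ E y x"
    using GBC_minus unfolding GBC_minus_def infinity_def is_succ_def by blast
  let ?A = "{x. E x w \<and> x \<in> Ords E}"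
  have "represented E ?A"
    by (rule represented_separation) (intro definable_intros)
  moreover have "z \<in> Ords E"
    using z(2) unfolding Ords_def transitive_def by blast
  moreover have "\<forall>x\<in>?A. \<forall>y. is_succ E y x \<longrightarrow> y \<in> ?A"
    using w succ_unique Ords_succ by (metis (mono_tags, lifting) mem_Collect_eq)
  moreover have "?A \<subseteq> Ords E"
    by blast
  moreover have "z \<in> ?A"
    using z(1) calculation(2) by simp
  moreover note z(2)
  ultimately show ?thesis
    by blast
qed

definition global_well_order :: "'a rel \<Rightarrow> bool" where
  "global_well_order r \<longleftrightarrow> fo (\<lambda>s. (s 0, s 1) \<in> r) \<and> asym r \<and> trans r \<and> total r \<and>
    (\<forall>Y\<in>K. Y \<noteq> {} \<longrightarrow> (\<exists>m\<in>Y. \<forall>y\<in>Y. y = m \<or> (m, y) \<in> r))"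

text \<open>Membership between ordinals is pulled back along the bijection given by global
  choice.\<close>

lemma ex_global_well_order: "\<exists>r. global_well_order r"
proof -
  obtain F where F: "class_fun E K F UNIV (Ords E)" and bij: "bij_betw (app E F) UNIV (Ords E)"
    using GBC_minus unfolding GBC_minus_def global_choice_def by blast
  define f where "f = app E F"
  have FK: "F \<in> K"
    using F unfolding class_fun_def by blast
  have f: "(x, y) \<in> rel E F \<longleftrightarrow> f x = y" for x y
    using app_eq_iff[OF F] unfolding f_def by simp
  have f_Ords: "f x \<in> Ords E" for x
    using app_in[OF F] unfolding f_def by simp
  have f_inj: "f x = f y \<Longrightarrow> x = y" for x y
    using bij unfolding f_def bij_betw_def by (blast dest: injD)
  define r where "r = {(x, y). E (f x) (f y)}"
  have r: "(x, y) \<in> r \<longleftrightarrow> E (f x) (f y)" for x y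
    unfolding r_def by simp
  have r_fo: "(x, y) \<in> r \<longleftrightarrow> (\<exists>a b. (x, a) \<in> rel E F \<and> (y, b) \<in> rel E F \<and> E a b)" for x y
    unfolding r f by blast
  have "fo (\<lambda>s. (s 0, s 1) \<in> r)"
    unfolding r_fo by (intro definable_intros FK)
  moreover have "asym r"
    unfolding asym_on_def r using mem_asym by blast
  moreover have "trans r"
    unfolding trans_on_def r using Ords_mem_trans[OF f_Ords] by blast
  moreover have total: "total r"
    unfolding total_on_def r using Ords_linear[OF f_Ords f_Ords] f_inj by blast
  moreover have "\<exists>m\<in>Y. \<forall>y\<in>Y. y = m \<or> (m, y) \<in> r" if Y: "Y \<in> K" "Y \<noteq> {}" for Y
  proof -
    have "{a. \<exists>y\<in>Y. (y, a) \<in> rel E F} \<in> K"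
      by (rule class_Collect) (intro definable_intros FK \<open>Y \<in> K\<close>)
    moreover have "{a. \<exists>y\<in>Y. (y, a) \<in> rel E F} = f ` Y"
      unfolding f by auto
    ultimately have "\<exists>a\<in>f ` Y. \<forall>b\<in>f ` Y. \<not> E b a"
      using Ords_min[of "f ` Y"] f_Ords Y(2) by auto
    then obtain m where "m \<in> Y" "\<And>y. y \<in> Y \<Longrightarrow> (y, m) \<notin> r"
      unfolding r by blast
    then show ?thesis
      using total unfolding total_on_def by blast
  qed
  ultimately show ?thesis
    unfolding global_well_order_def by blast
qed

text \<open>\<open>SOME\<close> fixes one order so that later definitions can mention it;
  \<open>global_well_order\<close> includes definability so that the chosen order has it.\<close>

definition wless :: "'a \<Rightarrow> 'a \<Rightarrow> bool" where
  "wless x y \<longleftrightarrow> (x, y) \<in> (SOME r. global_well_order r)"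

lemma
  shows wless_asym: "wless x y \<Longrightarrow> \<not> wless y x"
    and wless_trans: "wless x y \<Longrightarrow> wless y z \<Longrightarrow> wless x z"
    and wless_linear: "wless x y \<or> x = y \<or> wless y x"
    and wless_min: "Y \<in> K \<Longrightarrow> Y \<noteq> {} \<Longrightarrow> \<exists>m\<in>Y. \<forall>y\<in>Y. y = m \<or> wless m y"
    and definable_wless_var: "fo (\<lambda>s. wless (s 0) (s 1))"
proof -
  define r where "r = (SOME r. global_well_order r)"
  have "global_well_order r"
    unfolding r_def by (rule someI_ex[OF ex_global_well_order])
  then have r: "fo (\<lambda>s. (s 0, s 1) \<in> r)" "asym r" "trans r" "total r"
    "\<And>Y. Y \<in> K \<Longrightarrow> Y \<noteq> {} \<Longrightarrow> \<exists>m\<in>Y. \<forall>y\<in>Y. y = m \<or> (m, y) \<in> r"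
    unfolding global_well_order_def by auto
  have wless: "wless x y \<longleftrightarrow> (x, y) \<in> r" for x y
    unfolding wless_def r_def ..
  show "wless x y \<Longrightarrow> \<not> wless y x"
    unfolding wless using asymD[OF r(2)] .
  show "wless x y \<Longrightarrow> wless y z \<Longrightarrow> wless x z"
    unfolding wless using transD[OF r(3)] .
  show "wless x y \<or> x = y \<or> wless y x"
    unfolding wless using r(4) unfolding total_on_def by auto
  show "Y \<in> K \<Longrightarrow> Y \<noteq> {} \<Longrightarrow> \<exists>m\<in>Y. \<forall>y\<in>Y. y = m \<or> wless m y"
    unfolding wless by (rule r(5))
  show "fo (\<lambda>s. wless (s 0) (s 1))"
    unfolding wless by (rule r(1))
qed

lemma definable_wless:
  assumes "simple_term \<tau>" "simple_term \<sigma>"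
  shows "fo (\<lambda>s. wless (\<tau> s) (\<sigma> s))"
proof -
  define W where "W = {p. \<exists>x y. is_opair E p x y \<and> wless x y}"
  have "W \<in> K"
    unfolding W_def by (rule class_Collect_pairs) (rule definable_wless_var)
  then show ?thesis
    using definable_rel[OF _ assms, of W] unfolding W_def rel_Collect_pairs by simp
qed

end

section \<open>Elementary recursions\<close>

text \<open>\<open>ETR\<close> needs one formula that is right for all possible earlier stages
  \<open>A\<close> at once, while \<open>definable\<close> hides the formula behind fixed
  parameters. The recursion formulas are therefore written out.\<close>

definition ex_fm :: "nat \<Rightarrow> fm \<Rightarrow> fm" where
  "ex_fm i \<phi> = NotF (AllF i (NotF \<phi>))"

definition or_fm :: "fm \<Rightarrow> fm \<Rightarrow> fm" where
  "or_fm \<phi> \<psi> = NotF (AndF (NotF \<phi>) (NotF \<psi>))"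

definition imp_fm :: "fm \<Rightarrow> fm \<Rightarrow> fm" where
  "imp_fm \<phi> \<psi> = NotF (AndF \<phi> (NotF \<psi>))"

lemma sat_connectives [simp]:
  "sat E C s (ex_fm i \<phi>) \<longleftrightarrow> (\<exists>x. sat E C (s(i := x)) \<phi>)"
  "sat E C s (or_fm \<phi> \<psi>) \<longleftrightarrow> sat E C s \<phi> \<or> sat E C s \<psi>"
  "sat E C s (imp_fm \<phi> \<psi>) \<longleftrightarrow> (sat E C s \<phi> \<longrightarrow> sat E C s \<psi>)"
  by (simp_all add: ex_fm_def or_fm_def imp_fm_def)

text \<open>The variables from \<open>9\<close> on are reserved for the bound variables of these formulas.\<close>

definition upair_fm :: "nat \<Rightarrow> nat \<Rightarrow> nat \<Rightarrow> fm" where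
  "upair_fm p a b = AllF 12 (AndF (imp_fm (MemF 12 p) (or_fm (EqF 12 a) (EqF 12 b)))
    (imp_fm (or_fm (EqF 12 a) (EqF 12 b)) (MemF 12 p)))"

definition opair_fm :: "nat \<Rightarrow> nat \<Rightarrow> nat \<Rightarrow> fm" where
  "opair_fm p a b = ex_fm 10 (ex_fm 11
    (AndF (upair_fm 10 a a) (AndF (upair_fm 11 a b) (upair_fm p 10 11))))"

definition rel_fm :: "nat \<Rightarrow> nat \<Rightarrow> nat \<Rightarrow> fm" where
  "rel_fm k a b = ex_fm 9 (AndF (InClassF 9 k) (opair_fm 9 a b))"

lemma sat_upair_fm:
  "p < 12 \<Longrightarrow> a < 12 \<Longrightarrow> b < 12 \<Longrightarrow>
    sat E C s (upair_fm p a b) \<longleftrightarrow> is_upair E (s p) (s a) (s b)"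
  unfolding upair_fm_def is_upair_def by auto

lemma sat_opair_fm:
  "p < 10 \<Longrightarrow> a < 10 \<Longrightarrow> b < 10 \<Longrightarrow>
    sat E C s (opair_fm p a b) \<longleftrightarrow> is_opair E (s p) (s a) (s b)"
  unfolding opair_fm_def is_opair_def by (simp add: sat_upair_fm)

lemma sat_rel_fm:
  "a < 9 \<Longrightarrow> b < 9 \<Longrightarrow> sat E C s (rel_fm k a b) \<longleftrightarrow> (s a, s b) \<in> rel E (C k)"
  unfolding rel_fm_def in_rel_iff by (simp add: sat_opair_fm)

locale GBC_ETR = GBC +
  assumes ETR: "ETR E K"
begin

lemma rel_restr: "(a, x) \<in> rel E (restr E L S c) \<longleftrightarrow> (a, x) \<in> rel E S \<and> (a, c) \<in> strict E L"
  unfolding in_rel_iff restr_def using opair_inject by blast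

text \<open>Hides the coding in \<open>ETR\<close>: the step \<open>P\<close> receives the earlier
  stages as a HOL relation instead of a class of internal pairs.\<close>

lemma recursion:
  assumes "class_well_order E K \<Gamma> L" "Z \<in> K"
    and "\<And>A x. sat E (\<lambda>k. if k = 0 then A else Z) (\<lambda>_. x) \<phi> \<longleftrightarrow> P (rel E A) x"
  shows "\<exists>S\<in>K. \<forall>c\<in>\<Gamma>. \<forall>x. (c, x) \<in> rel E S \<longleftrightarrow>
    P {(d, a). (d, a) \<in> rel E S \<and> (d, c) \<in> strict E L} x"
proof -
  obtain S where S: "S \<in> K"
    "\<forall>c\<in>\<Gamma>. {x. (c, x) \<in> rel E S} =
      {x. sat E (\<lambda>k. if k = 0 then restr E L S c else Z) (\<lambda>_. x) \<phi>}"
    using ETR[unfolded ETR_def, rule_format, OF assms(1,2), of \<phi>] by auto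
  have restr: "rel E (restr E L S c) = {(d, a). (d, a) \<in> rel E S \<and> (d, c) \<in> strict E L}" for c
    using rel_restr by auto
  have "(c, x) \<in> rel E S \<longleftrightarrow> P {(d, a). (d, a) \<in> rel E S \<and> (d, c) \<in> strict E L} x"
    if "c \<in> \<Gamma>" for c x
  proof -
    have "x \<in> {x. (c, x) \<in> rel E S} \<longleftrightarrow> x \<in> {x. P (rel E (restr E L S c)) x}"
      using S(2) that unfolding assms(3) by (rule_tac arg_cong[where f = "(\<in>) x"]) (rule bspec)
    then show ?thesis
      by (simp add: restr)
  qed
  then show ?thesis
    by (intro bexI[OF _ S(1)]) simp
qed

section \<open>Least elements of classes\<close>

lemma class_well_order_Ords:
  "\<exists>L. class_well_order E K (Ords E) L \<and>
    (\<forall>x y. (x, y) \<in> strict E L \<longleftrightarrow> x \<in> Ords E \<and> y \<in> Ords E \<and> E x y)"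
proof -
  define L where "L = {p. \<exists>x y. is_opair E p x y \<and> x \<in> Ords E \<and> y \<in> Ords E \<and> (E x y \<or> x = y)}"
  have L: "(x, y) \<in> rel E L \<longleftrightarrow> x \<in> Ords E \<and> y \<in> Ords E \<and> (E x y \<or> x = y)" for x y
    unfolding L_def rel_Collect_pairs ..
  have strict: "(x, y) \<in> strict E L \<longleftrightarrow> x \<in> Ords E \<and> y \<in> Ords E \<and> E x y" for x y
    unfolding in_strict_iff L using mem_irrefl by blast
  have "L \<in> K"
    unfolding L_def by (rule class_Collect_pairs) (intro definable_intros)
  then have "class_rel E K (Ords E) L"
    unfolding class_rel_def using Ords_class by (auto simp: L_def cprod_def)
  moreover have "linear_order_on (Ords E) (rel E L)"
    unfolding linear_order_on_def partial_order_on_def preorder_on_def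
  proof (intro conjI)
    show "rel E L \<subseteq> Ords E \<times> Ords E" "refl_on (Ords E) (rel E L)"
      using L by (auto simp: refl_on_def)
    show "trans (rel E L)"
      unfolding trans_on_def L using Ords_mem_trans by blast
    show "antisym (rel E L)"
      unfolding antisym_on_def L using mem_asym by blast
    show "total_on (Ords E) (rel E L)"
      unfolding total_on_def L by (simp, metis Ords_linear)
  qed
  moreover have "well_founded_on E (Ords E) (strict E L)"
    unfolding well_founded_on_def strict
  proof (intro allI impI)
    fix s
    assume "\<exists>x. E x s"
    then have "{x. E x s} \<noteq> {}"
      by blast
    from represented_min[OF represented_members this]
    show "\<exists>m. E m s \<and> (\<forall>a. E a s \<longrightarrow> \<not> (a \<in> Ords E \<and> m \<in> Ords E \<and> E a m))"
      by blast
  qed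
  ultimately show ?thesis
    using strict unfolding class_well_order_def by blast
qed

text \<open>
  A class without minimal element would contain a descending sequence indexed by the
  finite ordinals. It is produced by a recursion along all ordinals whose stages
  \<open>D \<alpha>\<close> are cumulative, so that each of them is a set by replacement.
\<close>

lemma well_founded_class_min:
  assumes wf: "well_founded_on E X (rel E R)" and RK: "R \<in> K" and Y: "Y \<in> K" "Y \<subseteq> X" "Y \<noteq> {}"
  shows "\<exists>m\<in>Y. \<forall>a\<in>Y. (a, m) \<notin> rel E R"
proof (rule ccontr)
  assume "\<not> ?thesis"
  then have pred: "\<exists>a\<in>Y. (a, x) \<in> rel E R" if "x \<in> Y" for x
    using that by blast
  have wf': "\<exists>m\<in>A. \<forall>a\<in>A. (a, m) \<notin> rel E R" if "represented E A" "A \<subseteq> X" "A \<noteq> {}" for A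
    using wf that unfolding well_founded_on_def represented_def by (metis ex_in_conv subsetD)
  have irrefl: "(x, x) \<notin> rel E R" if "x \<in> X" for x
    using wf'[of "{x}"] represented_finite[of "{x}"] that by simp
  \<comment> \<open>Taking only the \<open>wless\<close>-least predecessor keeps the sections of the
    step relation finite; all predecessors in \<open>Y\<close> might form a proper class.\<close>
  define G where "G x y \<longleftrightarrow> x \<in> Y \<and> y \<in> Y \<and> (y, x) \<in> rel E R \<and>
    (\<forall>z\<in>Y. (z, x) \<in> rel E R \<longrightarrow> z = y \<or> wless y z)" for x y
  have G_sub: "y \<in> Y" if "G x y" for x y
    using that unfolding G_def by simp
  have G_unique: "y = y'" if "G x y" "G x y'" for x y y'
    using that wless_asym unfolding G_def by metis
  have G_ex: "\<exists>y. G x y" if "x \<in> Y" for x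
  proof -
    have "{y. y \<in> Y \<and> (y, x) \<in> rel E R} \<in> K"
      by (rule class_Collect) (intro definable_intros Y RK)
    from wless_min[OF this] show ?thesis
      using pred[OF that] that unfolding G_def by blast
  qed
  obtain y0 where y0: "y0 \<in> Y"
    using Y(3) by blast
  \<comment> \<open>With one class parameter and no set parameter allowed, \<open>y0\<close> is
    coded as a diagonal pair added to the graph of \<open>G\<close>. It can be read off again
    because \<open>R\<close> is irreflexive on \<open>X\<close>.\<close>
  define Z where "Z = {p. \<exists>x y. is_opair E p x y \<and> (x = y0 \<and> y = y0 \<or> G x y)}"
  have ZK: "Z \<in> K"
    unfolding Z_def G_def
    by (rule class_Collect_pairs) (intro definable_intros Y RK definable_wless)
  have Z: "(x, y) \<in> rel E Z \<longleftrightarrow> x = y0 \<and> y = y0 \<or> G x y" for x y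
    unfolding Z_def rel_Collect_pairs ..
  have Z_diag: "(x, x) \<in> rel E Z \<longleftrightarrow> x = y0" for x
    unfolding Z using irrefl Y(2) unfolding G_def by blast
  obtain L where L: "class_well_order E K (Ords E) L"
    "\<And>x y. (x, y) \<in> strict E L \<longleftrightarrow> x \<in> Ords E \<and> y \<in> Ords E \<and> E x y"
    using class_well_order_Ords by metis
  have sat: "sat E (\<lambda>k. if k = 0 then A else Z) (\<lambda>_. x)
      (or_fm (rel_fm 1 0 0) (ex_fm 1 (ex_fm 2 (AndF (rel_fm 0 2 1) (rel_fm 1 1 0)))))
      \<longleftrightarrow> (x, x) \<in> rel E Z \<or> (\<exists>a b. (b, a) \<in> rel E A \<and> (a, x) \<in> rel E Z)" for A x
    by (simp add: sat_rel_fm)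
  obtain S where S: "S \<in> K"
    "\<And>c x. c \<in> Ords E \<Longrightarrow> (c, x) \<in> rel E S \<longleftrightarrow> (x, x) \<in> rel E Z \<or>
      (\<exists>a b. ((b, a) \<in> rel E S \<and> (b, c) \<in> strict E L) \<and> (a, x) \<in> rel E Z)"
    using recursion[where P = "\<lambda>T x. (x, x) \<in> rel E Z \<or> (\<exists>a b. (b, a) \<in> T \<and> (a, x) \<in> rel E Z)",
      OF L(1) ZK sat] by auto
  define D where "D c = {x. (c, x) \<in> rel E S}" for c
  have D: "D c = insert y0 {x. \<exists>a. (\<exists>b. E b c \<and> a \<in> D b) \<and> (a, x) \<in> rel E Z}" if "c \<in> Ords E" for c
    using S(2)[OF that] Ords_members[OF that] that unfolding D_def Z_diag L(2) by auto
  have D_represented: "represented E (D c)" if "c \<in> Ords E" for c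
  proof (rule ccontr)
    assume "\<not> represented E (D c)"
    moreover have "fo (\<lambda>s. \<not> represented E (D (s 0)))"
      unfolding D_def represented_Collect by (intro definable_intros S(1))
    ultimately obtain m where m: "m \<in> Ords E" "\<not> represented E (D m)"
      and m_min: "\<And>b. E b m \<Longrightarrow> represented E (D b)"
      using Ords_least[of "\<lambda>c. \<not> represented E (D c)"] \<open>c \<in> Ords E\<close> by blast
    have "represented E {a. \<exists>b. E b m \<and> (b, a) \<in> rel E S}"
      by (rule represented_UN)
        (intro definable_intros S(1), use m_min in \<open>simp add: D_def\<close>)
    then obtain u where u: "\<And>a. E a u \<longleftrightarrow> (\<exists>b. E b m \<and> a \<in> D b)"
      unfolding represented_def D_def by blast
    have "represented E {x. (a, x) \<in> rel E Z}" for a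
    proof (rule represented_finite, rule finite_subset)
      \<comment> \<open>\<open>y0\<close> is the possible diagonal value. If \<open>G\<close> has no
        value at \<open>a\<close>, the arbitrary value of \<open>THE\<close> merely enlarges the
        bound.\<close>
      show "{x. (a, x) \<in> rel E Z} \<subseteq> {y0, THE y. G a y}"
        using Z G_unique by (auto intro: the_equality[symmetric])
    qed simp
    then have "represented E {x. \<exists>a. E a u \<and> (a, x) \<in> rel E Z}"
      by (intro represented_UN definable_intros ZK)
    then have "represented E (D m)"
      unfolding D[OF m(1)] u by (rule represented_insert)
    then show False
      using m(2) by blast
  qed
  obtain A z where A: "represented E A" "A \<subseteq> Ords E" "z \<in> A"
    and A_succ: "\<And>x y. x \<in> A \<Longrightarrow> is_succ E y x \<Longrightarrow> y \<in> A"
    using ex_inductive_Ords by metis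
  obtain w where w: "\<And>x. E x w \<longleftrightarrow> x \<in> A"
    using A(1) unfolding represented_def by blast
  \<comment> \<open>The union of the stages along \<open>A\<close> is a set, so well-foundedness
    applies to it. A minimal \<open>m\<close> from stage \<open>c\<close> has its
    \<open>G\<close>-value in the stage of the successor of \<open>c\<close>, which is the
    contradiction.\<close>
  have "represented E {x. \<exists>c. E c w \<and> (c, x) \<in> rel E S}"
    by (rule represented_UN)
      (intro definable_intros S(1), use w A(2) D_represented in \<open>auto simp: D_def\<close>)
  moreover have DY: "D c \<subseteq> Y" if "c \<in> Ords E" for c
    unfolding D[OF that] using y0 G_sub by (auto simp: Z)
  then have "{x. \<exists>c. E c w \<and> (c, x) \<in> rel E S} \<subseteq> X"
    using A(2) Y(2) unfolding w D_def by blast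
  moreover have "y0 \<in> D z"
    using D A by blast
  then have "{x. \<exists>c. E c w \<and> (c, x) \<in> rel E S} \<noteq> {}"
    using A(3) unfolding w D_def by blast
  ultimately obtain m c where m: "c \<in> A" "m \<in> D c" and
    m_min: "\<And>a b. b \<in> A \<Longrightarrow> a \<in> D b \<Longrightarrow> (a, m) \<notin> rel E R"
    using wf'[of "{x. \<exists>c. E c w \<and> (c, x) \<in> rel E S}"] unfolding w D_def by blast
  obtain a where a: "G m a"
    using G_ex DY m A(2) by blast
  obtain c' where c': "is_succ E c' c"
    using ex_succ by blast
  have "c' \<in> A"
    using A_succ m(1) c' .
  moreover have "(m, a) \<in> rel E Z"
    using a unfolding Z by simp
  ultimately have "a \<in> D c'"
    using D[of c'] A(2) succ_mem[OF c'] m(2) by blast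
  then show False
    using m_min \<open>c' \<in> A\<close> a unfolding G_def by blast
qed

lemma class_well_orderD:
  assumes "class_well_order E K \<Gamma> L"
  shows "\<Gamma> \<in> K" "L \<in> K"
    and "(x, y) \<in> rel E L \<Longrightarrow> x \<in> \<Gamma>" "(x, y) \<in> rel E L \<Longrightarrow> y \<in> \<Gamma>"
    and "(x, y) \<in> rel E L \<Longrightarrow> (y, z) \<in> rel E L \<Longrightarrow> (x, z) \<in> rel E L"
    and "(x, y) \<in> rel E L \<Longrightarrow> (y, x) \<in> rel E L \<Longrightarrow> x = y"
    and "x \<in> \<Gamma> \<Longrightarrow> y \<in> \<Gamma> \<Longrightarrow> (x, y) \<in> rel E L \<or> (y, x) \<in> strict E L"
proof -
  have L: "linear_order_on \<Gamma> (rel E L)"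
    using assms unfolding class_well_order_def by blast
  then have sub: "rel E L \<subseteq> \<Gamma> \<times> \<Gamma>" and "refl_on \<Gamma> (rel E L)" and tr: "trans (rel E L)"
    and asym: "antisym (rel E L)" and tot: "total_on \<Gamma> (rel E L)"
    unfolding linear_order_on_def partial_order_on_def preorder_on_def by blast+
  then have refl: "x \<in> \<Gamma> \<Longrightarrow> (x, x) \<in> rel E L" for x
    unfolding refl_on_def by blast
  show "\<Gamma> \<in> K" "L \<in> K"
    using assms unfolding class_well_order_def class_rel_def by blast+
  show "(x, y) \<in> rel E L \<Longrightarrow> x \<in> \<Gamma>" "(x, y) \<in> rel E L \<Longrightarrow> y \<in> \<Gamma>"
    using sub by blast+
  show "(x, y) \<in> rel E L \<Longrightarrow> (y, z) \<in> rel E L \<Longrightarrow> (x, z) \<in> rel E L"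
    using transD[OF tr] .
  show "(x, y) \<in> rel E L \<Longrightarrow> (y, x) \<in> rel E L \<Longrightarrow> x = y"
    using antisymD[OF asym] .
  show "x \<in> \<Gamma> \<Longrightarrow> y \<in> \<Gamma> \<Longrightarrow> (x, y) \<in> rel E L \<or> (y, x) \<in> strict E L"
    using tot refl unfolding total_on_def in_strict_iff by metis
qed

lemma class_well_order_min:
  assumes L: "class_well_order E K \<Gamma> L" and Y: "Y \<in> K" "Y \<subseteq> \<Gamma>" "Y \<noteq> {}"
  shows "\<exists>m\<in>Y. \<forall>y\<in>Y. (m, y) \<in> rel E L"
proof -
  \<comment> \<open>A class coding the HOL relation \<open>strict E L\<close>, as
    \<open>well_founded_class_min\<close> expects.\<close>
  define R where "R = {p. \<exists>x y. is_opair E p x y \<and> (x, y) \<in> strict E L}"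
  have R: "rel E R = strict E L"
    unfolding R_def using rel_Collect_pairs[of _ _ "\<lambda>x y. (x, y) \<in> strict E L"] by auto
  have "R \<in> K"
    unfolding R_def by (rule class_Collect_pairs) (intro definable_intros class_well_orderD(1,2)[OF L])
  moreover have "well_founded_on E \<Gamma> (rel E R)"
    using L unfolding R class_well_order_def by blast
  ultimately obtain m where "m \<in> Y" "\<forall>y\<in>Y. (y, m) \<notin> strict E L"
    using well_founded_class_min[OF _ _ Y, of R] unfolding R by blast
  then show ?thesis
    using class_well_orderD(7)[OF L] Y(2) by blast
qed

lemma class_well_order_least:
  assumes L: "class_well_order E K \<Gamma> L" and P: "fo (\<lambda>s. P (s 0))" "x \<in> \<Gamma>" "P x"
  shows "\<exists>m\<in>\<Gamma>. P m \<and> (\<forall>y\<in>\<Gamma>. P y \<longrightarrow> (m, y) \<in> rel E L)"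
proof -
  let ?Y = "{a. a \<in> \<Gamma> \<and> P a}"
  have "?Y \<in> K"
    by (rule class_Collect) (intro definable_intros class_well_orderD(1)[OF L] P(1))
  moreover have "x \<in> ?Y"
    using P(2,3) by simp
  ultimately have "\<exists>m\<in>?Y. \<forall>y\<in>?Y. (m, y) \<in> rel E L"
    by (intro class_well_order_min[OF L]) auto
  then show ?thesis by fast
qed

text \<open>
  The stage \<open>c\<close> of the recursion consists of the points of rank at most \<open>c\<close>, so the
  least stage containing \<open>x\<close> is a continuous rank of \<open>x\<close>. The relation \<open>P\<close> generalizes
  a ranking in that it may relate a point to many elements of \<open>\<Gamma>\<close>.
\<close>

lemma ex_continuous_ranking:
  assumes R: "class_rel E K X R" and L: "class_well_order E K \<Gamma> L"
    and P: "fo (\<lambda>s. P (s 0) (s 1))" "\<And>c x. P c x \<Longrightarrow> c \<in> \<Gamma>" "\<And>x. x \<in> X \<Longrightarrow> \<exists>c. P c x"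
    and P_step: "\<And>c x a. P c x \<Longrightarrow> (a, x) \<in> rel E R \<Longrightarrow> \<exists>d. (d, c) \<in> strict E L \<and> P d a"
  shows "\<exists>\<rho>. continuous_ranking E K X R \<Gamma> L \<rho> \<and>
    (\<forall>x\<in>X. \<forall>c. P c x \<longrightarrow> (app E \<rho> x, c) \<in> rel E L)"
proof -
  note LD = class_well_orderD[OF L]
  have RK: "R \<in> K" and XK: "X \<in> K" and R_sub: "R \<subseteq> cprod E X X"
    using R unfolding class_rel_def by auto
  have sat: "sat E (\<lambda>k. if k = 0 then A else R) (\<lambda>_. x)
      (AllF 1 (imp_fm (rel_fm 1 1 0) (ex_fm 2 (rel_fm 0 2 1))))
      \<longleftrightarrow> (\<forall>a. (a, x) \<in> rel E R \<longrightarrow> (\<exists>d. (d, a) \<in> rel E A))" for A x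
    by (simp add: sat_rel_fm)
  obtain S where SK: "S \<in> K" and S: "\<And>c x. c \<in> \<Gamma> \<Longrightarrow> (c, x) \<in> rel E S \<longleftrightarrow>
      (\<forall>a. (a, x) \<in> rel E R \<longrightarrow> (\<exists>d. (d, a) \<in> rel E S \<and> (d, c) \<in> strict E L))"
    using recursion[where P = "\<lambda>T x. \<forall>a. (a, x) \<in> rel E R \<longrightarrow> (\<exists>d. (d, a) \<in> T)",
      OF L RK sat] by auto
  have P_S: "(c, x) \<in> rel E S" if Pcx: "P c x" for c x
  proof (rule ccontr)
    assume *: "(c, x) \<notin> rel E S"
    have "fo (\<lambda>s. \<exists>x. P (s 0) x \<and> (s 0, x) \<notin> rel E S)"
    proof (intro definable_ex definable_and)
      show "fo (\<lambda>s. P (s (Suc 0)) (s 0))"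
        using definable_rename[OF P(1), of "\<lambda>i. 1 - i"] by simp
      show "fo (\<lambda>s. (s (Suc 0), s 0) \<notin> rel E S)"
        by (intro definable_intros SK)
    qed
    moreover have "\<exists>x. P c x \<and> (c, x) \<notin> rel E S"
      using Pcx * by blast
    ultimately obtain c where c_ex: "\<exists>x. P c x \<and> (c, x) \<notin> rel E S"
      and c_min: "\<forall>d\<in>\<Gamma>. (\<exists>a. P d a \<and> (d, a) \<notin> rel E S) \<longrightarrow> (c, d) \<in> rel E L"
      using class_well_order_least[where P = "\<lambda>c. \<exists>x. P c x \<and> (c, x) \<notin> rel E S",
          OF L _ P(2)[OF Pcx]] by blast
    then obtain x where c: "P c x" "(c, x) \<notin> rel E S"
      by blast
    obtain a where a: "(a, x) \<in> rel E R" "\<forall>d. (d, c) \<in> strict E L \<longrightarrow> (d, a) \<notin> rel E S"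
      using c(2) unfolding S[OF P(2)[OF c(1)]] by blast
    then obtain d where d: "(d, c) \<in> strict E L" "P d a"
      using P_step c(1) by blast
    then have "(c, d) \<in> rel E L"
      using c_min a(2) P(2) by blast
    then show False
      using d(1) LD(6) unfolding in_strict_iff by blast
  qed
  define r where "r x c \<longleftrightarrow> x \<in> X \<and> c \<in> \<Gamma> \<and> (c, x) \<in> rel E S \<and>
    (\<forall>d\<in>\<Gamma>. (d, x) \<in> rel E S \<longrightarrow> (c, d) \<in> rel E L)" for x c
  define \<rho> where "\<rho> = {p. \<exists>x c. is_opair E p x c \<and> r x c}"
  have \<rho>: "(x, c) \<in> rel E \<rho> \<longleftrightarrow> r x c" for x c
    unfolding \<rho>_def rel_Collect_pairs ..
  have \<rho>K: "\<rho> \<in> K"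
    unfolding \<rho>_def r_def by (rule class_Collect_pairs) (intro definable_intros XK SK LD(1,2))
  have r_unique: "c = d" if "r x c" "r x d" for x c d
    using that LD(6) unfolding r_def by blast
  have r_ex: "\<exists>c. r x c" if x: "x \<in> X" for x
  proof -
    obtain c where "c \<in> \<Gamma>" "(c, x) \<in> rel E S"
      using P(2,3) P_S x by blast
    moreover have "fo (\<lambda>s. (s 0, x) \<in> rel E S)"
      by (intro definable_intros SK)
    ultimately show ?thesis
      using class_well_order_least[OF L, of "\<lambda>c. (c, x) \<in> rel E S"] x unfolding r_def by blast
  qed
  have fn: "class_fun E K \<rho> X \<Gamma>"
    unfolding class_fun_def
  proof (intro conjI ballI)
    show "\<rho> \<subseteq> cprod E X \<Gamma>"
      unfolding \<rho>_def r_def cprod_def by blast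
    show "\<exists>!c. (x, c) \<in> rel E \<rho>" if "x \<in> X" for x
      unfolding \<rho> using r_ex[OF that] r_unique by blast
  qed (rule \<rho>K)
  have app: "r x (app E \<rho> x)" if "x \<in> X" for x
    using app_eq_iff[OF fn that] \<rho> by blast
  have app_le: "(app E \<rho> x, c) \<in> rel E L" if "x \<in> X" "c \<in> \<Gamma>" "(c, x) \<in> rel E S" for x c
    using app[OF that(1)] that unfolding r_def by blast
  have app_less: "(app E \<rho> a, app E \<rho> b) \<in> strict E L" if ab: "(a, b) \<in> rel E R" for a b
  proof -
    have "a \<in> X" "b \<in> X"
      using rel_cprodD[OF R_sub ab] by auto
    then have b: "app E \<rho> b \<in> \<Gamma>" "(app E \<rho> b, b) \<in> rel E S"
      using app unfolding r_def by auto
    then obtain d where d: "(d, app E \<rho> b) \<in> strict E L" "(d, a) \<in> rel E S"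
      using S ab by blast
    then have "(app E \<rho> a, d) \<in> rel E L"
      using app_le[OF \<open>a \<in> X\<close>] LD(3) unfolding in_strict_iff by blast
    then show ?thesis
      using d(1) LD(5,6) unfolding in_strict_iff by metis
  qed
  have "(app E \<rho> b, c) \<in> rel E L"
    if "b \<in> X" "c \<in> \<Gamma>" "\<forall>a. (a, b) \<in> rel E R \<longrightarrow> (app E \<rho> a, c) \<in> strict E L" for b c
  proof (rule app_le[OF that(1,2)])
    \<comment> \<open>The ranks of the predecessors of \<open>b\<close> are themselves the required
      stages before \<open>c\<close>.\<close>
    show "(c, b) \<in> rel E S"
      unfolding S[OF that(2)] using that(3) rel_cprodD[OF R_sub] app unfolding r_def by metis
  qed
  then have "continuous_ranking E K X R \<Gamma> L \<rho>"
    unfolding continuous_ranking_def ranking_def using fn app_less by blast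
  moreover have "(app E \<rho> x, c) \<in> rel E L" if "x \<in> X" "P c x" for x c
    using app_le P_S P(2) that by blast
  ultimately show ?thesis
    by blast
qed

end

section \<open>The Kleene--Brouwer order\<close>

context GBC
begin

text \<open>
  Descending sequences are indexed by an initial segment of the ordinals and descend at
  successor steps. Well-foundedness forces them to be finite, but this is never needed.
\<close>

definition descending :: "'a set \<Rightarrow> 'a set \<Rightarrow> 'a \<Rightarrow> bool" where
  "descending X R t \<longleftrightarrow>
    (\<forall>p. E p t \<longrightarrow> (\<exists>b a. is_opair E p b a \<and> b \<in> Ords E \<and> a \<in> X)) \<and>
    (\<forall>b a a'. maps E t b a \<longrightarrow> maps E t b a' \<longrightarrow> a = a') \<and>
    (\<forall>b c a. maps E t b a \<longrightarrow> E c b \<longrightarrow> (\<exists>a'. maps E t c a')) \<and>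
    (\<forall>b c a a'. is_succ E c b \<longrightarrow> maps E t b a \<longrightarrow> maps E t c a' \<longrightarrow> (a', a) \<in> rel E R)"

definition agree_below :: "'a \<Rightarrow> 'a \<Rightarrow> 'a \<Rightarrow> bool" where
  "agree_below b s t \<longleftrightarrow> (\<forall>c a. E c b \<longrightarrow> maps E s c a = maps E t c a)"

text \<open>
  If \<open>t\<close> is undefined at \<open>b\<close>, the last condition is vacuous, so proper extensions are smaller.
\<close>

definition kb_less :: "'a \<Rightarrow> 'a \<Rightarrow> bool" where
  "kb_less s t \<longleftrightarrow> (\<exists>b\<in>Ords E. agree_below b s t \<and>
    (\<exists>a. maps E s b a \<and> (\<forall>a'. maps E t b a' \<longrightarrow> wless a a')))"

section \<open>Linearity of the Kleene--Brouwer order\<close>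

lemma maps_in: "descending X R t \<Longrightarrow> maps E t b a \<Longrightarrow> b \<in> Ords E \<and> a \<in> X"
  unfolding descending_def maps_def using opair_inject by metis

lemma maps_unique: "descending X R t \<Longrightarrow> maps E t b a \<Longrightarrow> maps E t b a' \<Longrightarrow> a = a'"
  unfolding descending_def by metis

lemma maps_downward: "descending X R t \<Longrightarrow> maps E t b a \<Longrightarrow> E c b \<Longrightarrow> \<exists>a'. maps E t c a'"
  unfolding descending_def by metis

lemma maps_succ:
  "descending X R t \<Longrightarrow> is_succ E c b \<Longrightarrow> maps E t b a \<Longrightarrow> maps E t c a' \<Longrightarrow> (a', a) \<in> rel E R"
  unfolding descending_def by metis

lemma definable_descending:
  assumes "X \<in> K" "R \<in> K"
  shows "fo (\<lambda>s. descending X R (s i))"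
  unfolding descending_def by (intro definable_intros assms)

lemma definable_agree_below: "fo (\<lambda>s. agree_below (s i) (s j) (s k))"
  unfolding agree_below_def by (intro definable_intros)

lemma definable_kb_less: "fo (\<lambda>s. kb_less (s i) (s j))"
  unfolding kb_less_def by (intro definable_intros definable_agree_below definable_wless)

lemma agree_below_sym: "agree_below b s t \<Longrightarrow> agree_below b t s"
  unfolding agree_below_def by simp

lemma agree_below_trans: "agree_below b s t \<Longrightarrow> agree_below b t u \<Longrightarrow> agree_below b s u"
  unfolding agree_below_def by simp

lemma agree_below_mono: "agree_below b s t \<Longrightarrow> b \<in> Ords E \<Longrightarrow> E c b \<Longrightarrow> agree_below c s t"
  unfolding agree_below_def using Ords_mem_trans by metis

lemma agree_belowD: "agree_below b s t \<Longrightarrow> E c b \<Longrightarrow> maps E s c a \<longleftrightarrow> maps E t c a"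
  unfolding agree_below_def by simp

lemma kb_lessI:
  "b \<in> Ords E \<Longrightarrow> agree_below b s t \<Longrightarrow> maps E s b a \<Longrightarrow>
    (\<And>a'. maps E t b a' \<Longrightarrow> wless a a') \<Longrightarrow> kb_less s t"
  unfolding kb_less_def by blast

lemma kb_less_irrefl: "\<not> kb_less t t"
  unfolding kb_less_def using wless_asym by blast

text \<open>The earlier of the two deciding positions decides again; if they coincide, the entry of
  \<open>t\<close> there links the two \<open>wless\<close> comparisons.\<close>

lemma kb_less_trans:
  assumes "kb_less s t" "kb_less t u"
  shows "kb_less s u"
proof -
  obtain b a where b: "b \<in> Ords E" "agree_below b s t" "maps E s b a"
    "\<And>a'. maps E t b a' \<Longrightarrow> wless a a'"
    using assms(1) unfolding kb_less_def by blast
  obtain c d where c: "c \<in> Ords E" "agree_below c t u" "maps E t c d"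
    "\<And>a'. maps E u c a' \<Longrightarrow> wless d a'"
    using assms(2) unfolding kb_less_def by blast
  consider "E b c" | "b = c" | "E c b"
    using Ords_linear[OF b(1) c(1)] by blast
  then show ?thesis
  proof cases
    case 1
    show ?thesis
    proof (rule kb_lessI[OF b(1) _ b(3)])
      show "agree_below b s u"
        using agree_below_trans[OF b(2) agree_below_mono[OF c(2,1) 1]] .
      show "wless a a'" if "maps E u b a'" for a'
        using b(4) that agree_belowD[OF c(2) 1] by simp
    qed
  next
    case 2
    show ?thesis
    proof (rule kb_lessI[OF b(1) _ b(3)])
      show "agree_below b s u"
        using agree_below_trans[OF b(2)] c(2) 2 by simp
      show "wless a a'" if "maps E u b a'" for a'
        using b(4) c(3,4) that wless_trans unfolding 2 by blast
    qed
  next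
    case 3
    show ?thesis
    proof (rule kb_lessI[OF c(1) _ _ c(4)])
      show "agree_below c s u"
        using agree_below_trans[OF agree_below_mono[OF b(2,1) 3] c(2)] .
      show "maps E s c d"
        using c(3) agree_belowD[OF b(2) 3] by simp
    qed
  qed
qed

text \<open>A descending sequence contains nothing but ordered pairs, so its entries determine
  it.\<close>

lemma descending_eqI:
  assumes "descending X R s" "descending X R t" "\<And>b a. maps E s b a \<longleftrightarrow> maps E t b a"
  shows "s = t"
proof (rule extensionality)
  have sub: "E p v"
    if u: "descending X R u" "E p u" and uv: "\<And>b a. maps E u b a \<longleftrightarrow> maps E v b a" for p u v
  proof -
    obtain b a where p: "is_opair E p b a"
      using u unfolding descending_def by blast
    then have "maps E v b a"
      using u(2) uv[of b a] unfolding maps_def by blast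
    then show ?thesis
      using p opair_unique unfolding maps_def by blast
  qed
  show "E p s \<longleftrightarrow> E p t" for p
    using sub[OF assms(1) _ assms(3)] sub[OF assms(2) _ assms(3)[symmetric]] by blast
qed

text \<open>The least position with different entries decides: by \<open>wless\<close> if both
  sequences are defined there, otherwise the defined one is smaller.\<close>

lemma kb_less_linear:
  assumes st: "descending X R s" "descending X R t"
  shows "kb_less s t \<or> s = t \<or> kb_less t s"
proof (rule ccontr)
  assume *: "\<not> ?thesis"
  have compare: "kb_less u v \<or> kb_less v u"
    if "descending X R u" "descending X R v" "b \<in> Ords E" "agree_below b u v"
      "maps E u b a" "\<not> maps E v b a" for u v b a
  proof (cases "\<exists>a'. maps E v b a'")
    case True
    then obtain a' where a': "maps E v b a'"
      by blast
    then have "a \<noteq> a'"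
      using that(6) by blast
    then consider "wless a a'" | "wless a' a"
      using wless_linear by blast
    then show ?thesis
    proof cases
      case 1
      have "kb_less u v"
        by (rule kb_lessI[OF that(3,4,5)]) (use 1 maps_unique[OF that(2) a'] in blast)
      then show ?thesis ..
    next
      case 2
      have "kb_less v u"
        by (rule kb_lessI[OF that(3) agree_below_sym[OF that(4)] a'])
          (use 2 maps_unique[OF that(1,5)] in blast)
      then show ?thesis ..
    qed
  next
    case False
    then show ?thesis
      using kb_lessI[OF that(3,4,5)] by blast
  qed
  obtain b where b: "\<exists>a. maps E s b a \<noteq> maps E t b a"
    using descending_eqI[OF st] * by blast
  then have "b \<in> Ords E"
    using maps_in st by blast
  moreover have "fo (\<lambda>v. \<exists>a. maps E s (v 0) a \<noteq> maps E t (v 0) a)"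
    by (intro definable_intros)
  ultimately obtain m where m: "m \<in> Ords E" "\<exists>a. maps E s m a \<noteq> maps E t m a"
    and m_min: "\<And>c. E c m \<Longrightarrow> \<not> (\<exists>a. maps E s c a \<noteq> maps E t c a)"
    using Ords_least[of "\<lambda>b. \<exists>a. maps E s b a \<noteq> maps E t b a"] b by blast
  have agree: "agree_below m s t"
    using m_min unfolding agree_below_def by simp
  obtain a where "maps E s m a \<and> \<not> maps E t m a \<or> maps E t m a \<and> \<not> maps E s m a"
    using m(2) by blast
  then show False
    using compare[OF st m(1) agree] compare[OF st(2,1) m(1) agree_below_sym[OF agree]] * by blast
qed

section \<open>Well-foundedness of the Kleene--Brouwer order\<close>

text \<open>
  In a set \<open>S\<close> of descending sequences, \<open>u\<close> is leftmost below \<open>b\<close> if at each position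
  below \<open>b\<close> its value is least among the members of \<open>S\<close> agreeing with it so far. If
  there were leftmost members for arbitrarily long finite initial segments, their common
  values would form a descending sequence; so the leftmost members get stuck at some \<open>b\<close>.
\<close>

definition leftmost :: "'a \<Rightarrow> 'a \<Rightarrow> 'a \<Rightarrow> bool" where
  "leftmost S b u \<longleftrightarrow> E u S \<and> (\<forall>c. E c b \<longrightarrow> (\<exists>a. maps E u c a \<and>
    (\<forall>v a'. E v S \<longrightarrow> agree_below c v u \<longrightarrow> maps E v c a' \<longrightarrow> a' = a \<or> wless a a')))"

lemma definable_leftmost: "fo (\<lambda>s. leftmost S (s i) (s j))"
  unfolding leftmost_def by (intro definable_intros definable_agree_below definable_wless)

text \<open>At a first disagreement each of \<open>u\<close> and \<open>v\<close> competes with the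
  other, so both entries are least and hence equal.\<close>

lemma leftmost_agree:
  assumes S: "\<And>t. E t S \<Longrightarrow> descending X R t"
    and b: "b \<in> Ords E" and uv: "leftmost S b u" "leftmost S b v"
  shows "agree_below b u v"
proof (rule ccontr)
  assume "\<not> ?thesis"
  then obtain c where c: "E c b \<and> (\<exists>a. maps E u c a \<noteq> maps E v c a)"
    unfolding agree_below_def by blast
  then have "c \<in> Ords E"
    using Ords_members[OF b] by blast
  moreover have "fo (\<lambda>s. E (s 0) b \<and> (\<exists>a. maps E u (s 0) a \<noteq> maps E v (s 0) a))"
    by (intro definable_intros)
  ultimately obtain m where m: "E m b" "\<exists>a. maps E u m a \<noteq> maps E v m a"
    and m_min: "\<And>c. E c m \<Longrightarrow> \<not> (E c b \<and> (\<exists>a. maps E u c a \<noteq> maps E v c a))"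
    using Ords_least[of "\<lambda>c. E c b \<and> (\<exists>a. maps E u c a \<noteq> maps E v c a)"] c by blast
  have agree: "agree_below m u v"
    using m_min Ords_mem_trans[OF b _ m(1)] unfolding agree_below_def by blast
  have S_uv: "E u S" "E v S"
    using uv unfolding leftmost_def by auto
  obtain a where a: "maps E u m a"
    "\<And>w a'. E w S \<Longrightarrow> agree_below m w u \<Longrightarrow> maps E w m a' \<Longrightarrow> a' = a \<or> wless a a'"
    using uv(1) m(1) unfolding leftmost_def by blast
  obtain d where d: "maps E v m d"
    "\<And>w a'. E w S \<Longrightarrow> agree_below m w v \<Longrightarrow> maps E w m a' \<Longrightarrow> a' = d \<or> wless d a'"
    using uv(2) m(1) unfolding leftmost_def by blast
  have "a = d"
    using a(2)[OF S_uv(2) agree_below_sym[OF agree] d(1)] d(2)[OF S_uv(1) agree a(1)] wless_asym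
    by blast
  then show False
    using m(2) a(1) d(1) maps_unique[OF S[OF S_uv(1)]] maps_unique[OF S[OF S_uv(2)]] by blast
qed

lemma leftmost_mono: "leftmost S b u \<Longrightarrow> b \<in> Ords E \<Longrightarrow> E c b \<Longrightarrow> leftmost S c u"
  unfolding leftmost_def using Ords_mem_trans by metis

text \<open>Among the members of \<open>S\<close> that agree with \<open>u\<close> below
  \<open>b\<close>, one with the \<open>wless\<close>-least entry at \<open>b\<close> works;
  \<open>v\<close> guarantees that there is such an entry.\<close>

lemma leftmost_extend:
  assumes b_Ord: "b \<in> Ords E" and u: "leftmost S b u" and b: "is_succ E c b"
    and v: "E v S" "agree_below b v u" "maps E v b a"
  shows "\<exists>w. leftmost S c w"
proof -
  have "{a. \<exists>v. E v S \<and> agree_below b v u \<and> maps E v b a} \<in> K"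
    unfolding agree_below_def by (rule class_Collect) (intro definable_intros)
  moreover have "a \<in> {a. \<exists>v. E v S \<and> agree_below b v u \<and> maps E v b a}"
    using v by blast
  ultimately have "\<exists>m\<in>{a. \<exists>v. E v S \<and> agree_below b v u \<and> maps E v b a}.
      \<forall>y\<in>{a. \<exists>v. E v S \<and> agree_below b v u \<and> maps E v b a}. y = m \<or> wless m y"
    by (intro wless_min) auto
  then obtain m w where w: "E w S" "agree_below b w u" "maps E w b m"
    and m: "\<And>v a'. E v S \<Longrightarrow> agree_below b v u \<Longrightarrow> maps E v b a' \<Longrightarrow> a' = m \<or> wless m a'"
    by blast
  have "\<exists>a. maps E w d a \<and>
      (\<forall>v a'. E v S \<longrightarrow> agree_below d v w \<longrightarrow> maps E v d a' \<longrightarrow> a' = a \<or> wless a a')"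
    if "E d c" for d
  proof (cases "d = b")
    case True
    then show ?thesis
      using w(3) m agree_below_trans[OF _ w(2)] by blast
  next
    case False
    then have d: "E d b"
      using b that unfolding is_succ_def by blast
    obtain a where a: "maps E u d a"
      "\<And>v a'. E v S \<Longrightarrow> agree_below d v u \<Longrightarrow> maps E v d a' \<Longrightarrow> a' = a \<or> wless a a'"
      using u d unfolding leftmost_def by blast
    have "maps E w d a"
      using a(1) agree_belowD[OF w(2) d] by simp
    moreover have "agree_below d w u"
      using agree_below_mono[OF w(2) b_Ord d] .
    ultimately show ?thesis
      using a(2) agree_below_trans by blast
  qed
  then show ?thesis
    using w(1) unfolding leftmost_def by blast
qed

text \<open>A set \<open>S\<close> of the model suffices here, since \<open>well_founded_on\<close>
  tests only sets; classes are reached later through \<open>well_founded_class_min\<close>.\<close>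

lemma kb_less_well_founded:
  assumes wf: "well_founded_on E X (rel E R)" and RK: "R \<in> K" and XK: "X \<in> K"
    and S: "\<And>t. E t S \<Longrightarrow> descending X R t" and u0: "E u0 S"
  shows "\<exists>u. E u S \<and> (\<forall>v. E v S \<longrightarrow> \<not> kb_less v u)"
proof -
  have "\<exists>b u. b \<in> Ords E \<and> leftmost S b u \<and> (\<forall>v a. E v S \<longrightarrow> agree_below b v u \<longrightarrow> \<not> maps E v b a)"
  proof (rule ccontr)
    assume *: "\<not> ?thesis"
    have extend: "\<exists>w. leftmost S c w" if "b \<in> Ords E" "leftmost S b u" "is_succ E c b" for b c u
      using * leftmost_extend[OF that] that(1,2) by blast
    obtain A z where A: "represented E A" "A \<subseteq> Ords E" "z \<in> A" "\<And>x. \<not> E x z"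
      and A_succ: "\<And>x y. x \<in> A \<Longrightarrow> is_succ E y x \<Longrightarrow> y \<in> A"
      using ex_inductive_Ords by metis
    obtain w where w: "\<And>x. E x w \<longleftrightarrow> x \<in> A"
      using A(1) unfolding represented_def by blast
    \<comment> \<open>\<open>P\<close> reads off the common entry at \<open>b\<close>. Leftmost
      below the successor \<open>c\<close> is required because it controls the positions up to and
      including \<open>b\<close>.\<close>
    define P where "P b a \<longleftrightarrow> b \<in> Ords E \<and> (\<exists>c u. is_succ E c b \<and> leftmost S c u \<and> maps E u b a)" for b a
    have P_unique: "a = a'" if P: "P b a" "P b a'" for b a a'
    proof -
      obtain c u where u: "b \<in> Ords E" "is_succ E c b" "leftmost S c u" "maps E u b a"
        using P(1) unfolding P_def by blast
      obtain c' v where v: "is_succ E c' b" "leftmost S c' v" "maps E v b a'"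
        using P(2) unfolding P_def by blast
      have "c' = c"
        using succ_unique[OF v(1) u(2)] .
      then have "agree_below c u v"
        using leftmost_agree[OF S Ords_succ[OF u(1,2)] u(3)] v(2) by simp
      then have "maps E v b a"
        using u(4) agree_belowD succ_mem[OF u(2)] by blast
      moreover have "E v S"
        using v(2) unfolding leftmost_def by blast
      ultimately show ?thesis
        using maps_unique[OF S] v(3) by blast
    qed
    have P_ex: "\<exists>a. P b a" if b: "b \<in> Ords E" "leftmost S b u" for b u
    proof -
      obtain c where c: "is_succ E c b"
        using ex_succ by blast
      then obtain v where v: "leftmost S c v"
        using extend b by blast
      then obtain a where "maps E v b a"
        using succ_mem[OF c] unfolding leftmost_def by blast
      then show ?thesis
        using b(1) c v unfolding P_def by blast
    qed
    have P_in: "a \<in> X" if "P b a" for b a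
      using that S maps_in unfolding P_def leftmost_def by metis
    have "fo (\<lambda>s. P (s 0) (s 1))"
      unfolding P_def by (intro definable_intros definable_leftmost)
    \<comment> \<open>Well-foundedness of \<open>R\<close> tests only sets, so the common entries
      over the inductive set are gathered by replacement.\<close>
    then have "represented E {a. \<exists>b. E b w \<and> P b a}"
      by (rule represented_image) (rule P_unique)
    then obtain d where d: "\<And>a. E a d \<longleftrightarrow> (\<exists>b\<in>A. P b a)"
      unfolding represented_Collect w Bex_def by blast
    \<comment> \<open>\<open>z\<close> is empty, so any member of \<open>S\<close> qualifies and the
      common entries get started.\<close>
    have "leftmost S z u0"
      using u0 A(4) unfolding leftmost_def by simp
    then have "\<exists>a. E a d"
      using P_ex A(2,3) unfolding d by blast
    moreover have "\<forall>a. E a d \<longrightarrow> a \<in> X"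
      using P_in unfolding d by blast
    ultimately obtain m where "E m d" and m_min: "\<And>a. E a d \<Longrightarrow> (a, m) \<notin> rel E R"
      using wf unfolding well_founded_on_def by metis
    then obtain b where b: "b \<in> A" "P b m"
      unfolding d by blast
    then obtain c u where u: "b \<in> Ords E" "is_succ E c b" "leftmost S c u" "maps E u b m"
      unfolding P_def by blast
    have c: "c \<in> Ords E" "c \<in> A"
      using Ords_succ[OF u(1,2)] A_succ[OF b(1) u(2)] by auto
    obtain a where a: "P c a"
      using P_ex[OF c(1) u(3)] by blast
    then obtain c' v where v: "is_succ E c' c" "leftmost S c' v" "maps E v c a"
      unfolding P_def by blast
    \<comment> \<open>A member leftmost beyond \<open>c\<close> shares the entry \<open>m\<close> at
      \<open>b\<close>; as it descends from \<open>b\<close> to \<open>c\<close>, its next entry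
      \<open>a\<close> lies below \<open>m\<close>.\<close>
    have "leftmost S c v"
      using leftmost_mono[OF v(2) Ords_succ[OF c(1) v(1)] succ_mem[OF v(1)]] .
    then have "agree_below c u v"
      using leftmost_agree[OF S c(1) u(3)] by simp
    then have "maps E v b m"
      using u(4) agree_belowD succ_mem[OF u(2)] by blast
    moreover have "E v S"
      using v(2) unfolding leftmost_def by blast
    ultimately have "(a, m) \<in> rel E R"
      using maps_succ[OF S u(2)] v(3) by blast
    moreover have "E a d"
      using a c(2) unfolding d by blast
    ultimately show False
      using m_min by blast
  qed
  then obtain b u where b: "b \<in> Ords E" and u: "leftmost S b u"
    and stuck: "\<And>v a. E v S \<Longrightarrow> agree_below b v u \<Longrightarrow> \<not> maps E v b a"
    by blast
  \<comment> \<open>Let \<open>c\<close> be the position deciding \<open>kb_less v u\<close>. If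
    \<open>c\<close> is before \<open>b\<close>, then \<open>v\<close> would beat a least entry;
    otherwise \<open>v\<close> has an entry at \<open>b\<close> and agrees with \<open>u\<close>
    below \<open>b\<close>, against \<open>stuck\<close>.\<close>
  have "\<not> kb_less v u" if v: "E v S" for v
  proof
    assume less: "kb_less v u"
    then obtain c a where c: "c \<in> Ords E" "agree_below c v u" "maps E v c a"
      "\<And>a'. maps E u c a' \<Longrightarrow> wless a a'"
      using less unfolding kb_less_def by blast
    consider "E c b" | "c = b" | "E b c"
      using Ords_linear[OF b c(1)] by blast
    then show False
    proof cases
      case 1
      then obtain a' where "maps E u c a'" "a = a' \<or> wless a' a"
        using u v c(2,3) unfolding leftmost_def by blast
      then show False
        using c(4) wless_asym by blast
    next
      case 2
      then show False
        using stuck v c(2,3) by blast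
    next
      case 3
      then show False
        using stuck[OF v agree_below_mono[OF c(2,1) 3]] maps_downward[OF S[OF v] c(3) 3] by blast
    qed
  qed
  moreover have "E u S"
    using u unfolding leftmost_def by blast
  ultimately show ?thesis
    by blast
qed

definition kb_order :: "'a set \<Rightarrow> 'a set \<Rightarrow> 'a set" where
  "kb_order X R = {p. \<exists>s t. is_opair E p s t \<and>
    descending X R s \<and> descending X R t \<and> (kb_less s t \<or> s = t)}"

lemma kb_order_iff:
  "(s, t) \<in> rel E (kb_order X R) \<longleftrightarrow>
    descending X R s \<and> descending X R t \<and> (kb_less s t \<or> s = t)"
  unfolding kb_order_def rel_Collect_pairs ..

lemma class_well_order_kb:
  assumes wf: "wf_class_rel E K X R"
  shows "class_well_order E K {t. descending X R t} (kb_order X R)"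
proof -
  have XK: "X \<in> K" and RK: "R \<in> K" and wf: "well_founded_on E X (rel E R)"
    using wf unfolding wf_class_rel_def class_rel_def by auto
  have "{t. descending X R t} \<in> K"
    by (rule class_Collect) (rule definable_descending[OF XK RK])
  moreover have "kb_order X R \<in> K"
    unfolding kb_order_def
    by (rule class_Collect_pairs)
      (intro definable_base definable_descending XK RK definable_kb_less)
  ultimately have "class_rel E K {t. descending X R t} (kb_order X R)"
    unfolding class_rel_def by (auto simp: kb_order_def cprod_def)
  moreover have "linear_order_on {t. descending X R t} (rel E (kb_order X R))"
    unfolding linear_order_on_def partial_order_on_def preorder_on_def
  proof (intro conjI)
    show "rel E (kb_order X R) \<subseteq> {t. descending X R t} \<times> {t. descending X R t}"
      "refl_on {t. descending X R t} (rel E (kb_order X R))"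
      by (auto simp: kb_order_iff refl_on_def)
    show "trans (rel E (kb_order X R))"
      unfolding trans_on_def kb_order_iff using kb_less_trans by blast
    show "antisym (rel E (kb_order X R))"
      unfolding antisym_on_def kb_order_iff using kb_less_trans kb_less_irrefl by blast
    show "total_on {t. descending X R t} (rel E (kb_order X R))"
      unfolding total_on_def kb_order_iff using kb_less_linear by blast
  qed
  moreover have "well_founded_on E {t. descending X R t} (strict E (kb_order X R))"
    unfolding well_founded_on_def in_strict_iff kb_order_iff
    using kb_less_well_founded[OF wf RK XK] by (metis mem_Collect_eq)
  ultimately show ?thesis
    unfolding class_well_order_def by blast
qed

section \<open>Sequences ending in a given point\<close>

definition last_value :: "'a \<Rightarrow> 'a \<Rightarrow> bool" where
  "last_value t x \<longleftrightarrow> (\<exists>b. maps E t b x \<and> (\<forall>c a. maps E t c a \<longrightarrow> \<not> E b c))"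

lemma definable_last_value: "fo (\<lambda>s. last_value (s i) (s j))"
  unfolding last_value_def by (intro definable_intros)

lemma maps_insert:
  assumes "\<And>q. E q t' \<longleftrightarrow> E q t \<or> q = p" "is_opair E p c a"
  shows "maps E t' d y \<longleftrightarrow> maps E t d y \<or> d = c \<and> y = a"
  using assms opair_inject unfolding maps_def by metis

lemma ex_descending_singleton:
  assumes "x \<in> X"
  shows "\<exists>t. descending X R t \<and> last_value t x"
proof -
  \<comment> \<open>The positions must form an initial segment, so a single entry has to sit at the
    empty ordinal.\<close>
  obtain z where z: "\<And>y. \<not> E y z" "z \<in> Ords E"
    using ex_inductive_Ords by blast
  obtain p where p: "is_opair E p z x"
    using ex_opair by blast
  obtain t where t: "\<And>q. E q t \<longleftrightarrow> q = p"
    using represented_finite[of "{p}"] unfolding represented_def by auto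
  have maps: "maps E t b a \<longleftrightarrow> b = z \<and> a = x" for b a
    using p opair_inject unfolding maps_def t by metis
  have "descending X R t"
    unfolding descending_def maps using p z assms unfolding t is_succ_def by blast
  moreover have "last_value t x"
    unfolding last_value_def maps using z(1) by blast
  ultimately show ?thesis
    by blast
qed

text \<open>Append \<open>a\<close> at the position after the last one. There \<open>t\<close> is
  undefined, so the comparison of entries in \<open>kb_less\<close> holds vacuously.\<close>

lemma ex_descending_extension:
  assumes t: "descending X R t" "last_value t x" and R: "R \<subseteq> cprod E X X" and a: "(a, x) \<in> rel E R"
  shows "\<exists>t'. descending X R t' \<and> last_value t' a \<and> kb_less t' t"
proof -
  obtain b where b: "maps E t b x" and b_last: "\<And>c a. maps E t c a \<Longrightarrow> \<not> E b c"
    using t(2) unfolding last_value_def by blast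
  have b_Ord: "b \<in> Ords E"
    using maps_in[OF t(1) b] by simp
  obtain c where c: "is_succ E c b"
    using ex_succ by blast
  have c_mem: "E d c \<longleftrightarrow> E d b \<or> d = b" for d
    using c unfolding is_succ_def by simp
  have c_Ord: "c \<in> Ords E"
    using Ords_succ[OF b_Ord c] .
  have c_new: "\<not> maps E t c y" for y
    using b_last succ_mem[OF c] by blast
  obtain p where p: "is_opair E p c a"
    using ex_opair by blast
  obtain t' where t': "\<And>q. E q t' \<longleftrightarrow> E q t \<or> q = p"
    using represented_insert[OF represented_members[of t], of p] unfolding represented_def by auto
  have maps: "maps E t' d y \<longleftrightarrow> maps E t d y \<or> d = c \<and> y = a" for d y
    using maps_insert[OF t' p] .
  have aX: "a \<in> X"
    using rel_cprodD[OF R a] by simp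
  have above: "\<not> E c d" if "maps E t d y" for d y
    using that b_last Ords_mem_trans[OF _ succ_mem[OF c]] maps_in[OF t(1)] by blast
  have "descending X R t'"
    unfolding descending_def
  proof (intro conjI allI impI)
    show "\<exists>b a. is_opair E q b a \<and> b \<in> Ords E \<and> a \<in> X" if "E q t'" for q
      using that p c_Ord aX t(1) unfolding t' descending_def by blast
    show "y = y'" if "maps E t' d y" "maps E t' d y'" for d y y'
      using that maps_unique[OF t(1)] c_new unfolding maps by blast
    show "\<exists>y'. maps E t' e y'" if "maps E t' d y" "E e d" for d e y
      using that maps_downward[OF t(1)] b unfolding maps c_mem by (metis c_mem)
    show "(y', y) \<in> rel E R" if ed: "is_succ E e d" "maps E t' d y" "maps E t' e y'" for d e y y'
    proof -
      consider "maps E t d y" "maps E t e y'" | "maps E t d y" "e = c" "y' = a" | "d = c" "maps E t e y'"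
        | "d = c" "e = c"
        using ed(2,3) unfolding maps by blast
      then show ?thesis
      proof cases
        case 1
        then show ?thesis
          using maps_succ[OF t(1) ed(1)] by blast
      next
        case 2
        \<comment> \<open>\<open>c\<close> is the successor of both \<open>d\<close> and
          \<open>b\<close>; if these were distinct, each would be a member of the other.\<close>
        have "E d b \<or> d = b" "E b d \<or> b = d"
          using succ_mem[OF ed(1)] succ_mem[OF c] ed(1) 2(2) c_mem unfolding is_succ_def by auto
        then have "d = b"
          using mem_asym by blast
        then show ?thesis
          using 2 maps_unique[OF t(1) b] a by blast
      next
        case 3
        then show ?thesis
          using above succ_mem[OF ed(1)] by blast
      next
        case 4
        then show ?thesis
          using succ_mem[OF ed(1)] mem_irrefl by blast
      qed
    qed
  qed
  moreover have "last_value t' a"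
    unfolding last_value_def maps using above mem_irrefl by blast
  moreover have "kb_less t' t"
  proof (rule kb_lessI[OF c_Ord])
    show "agree_below c t' t"
      unfolding agree_below_def maps using mem_irrefl by blast
    show "maps E t' c a"
      unfolding maps by blast
    show "wless a a'" if "maps E t c a'" for a'
      using that c_new by blast
  qed
  ultimately show ?thesis
    by blast
qed

end

section \<open>Existence and refinement of rankings\<close>

context GBC_ETR
begin

lemma ex_class_ranking:
  assumes wf: "wf_class_rel E K X R"
  shows "\<exists>\<Gamma> L \<rho>. class_well_order E K \<Gamma> L \<and> continuous_ranking E K X R \<Gamma> L \<rho>"
proof -
  have R: "class_rel E K X R" "X \<in> K" "R \<in> K" "R \<subseteq> cprod E X X"
    using wf unfolding wf_class_rel_def class_rel_def by auto
  have "\<exists>\<rho>. continuous_ranking E K X R {t. descending X R t} (kb_order X R) \<rho> \<and>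
    (\<forall>x\<in>X. \<forall>t. descending X R t \<and> last_value t x \<longrightarrow> (app E \<rho> x, t) \<in> rel E (kb_order X R))"
  proof (rule ex_continuous_ranking[OF R(1) class_well_order_kb[OF wf]])
    show "fo (\<lambda>s. descending X R (s 0) \<and> last_value (s 0) (s 1))"
      by (intro definable_and definable_descending R definable_last_value)
    show "\<exists>t. descending X R t \<and> last_value t x" if "x \<in> X" for x
      using ex_descending_singleton[OF that] .
    show "\<exists>t'. (t', t) \<in> strict E (kb_order X R) \<and> descending X R t' \<and> last_value t' a"
      if "descending X R t \<and> last_value t x" "(a, x) \<in> rel E R" for t x a
      using ex_descending_extension[OF _ _ R(4) that(2)] that(1) kb_less_irrefl
      unfolding in_strict_iff kb_order_iff by blast
  qed simp
  then show ?thesis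
    using class_well_order_kb[OF wf] by blast
qed

text \<open>The reversed graph of \<open>\<pi>\<close> serves as \<open>P\<close> in
  \<open>ex_continuous_ranking\<close>: its step condition says that \<open>\<pi>\<close> strictly
  decreases along \<open>R\<close>, and the bound obtained there is the refinement.\<close>

lemma refine_class_ranking:
  assumes wf: "wf_class_rel E K X R" and L: "class_well_order E K \<Gamma> L"
    and \<pi>: "ranking E K X R \<Gamma> L \<pi>"
  shows "\<exists>\<rho>. continuous_ranking E K X R \<Gamma> L \<rho> \<and> (\<forall>x\<in>X. (app E \<rho> x, app E \<pi> x) \<in> rel E L)"
proof -
  have R: "class_rel E K X R" "R \<subseteq> cprod E X X"
    using wf unfolding wf_class_rel_def class_rel_def by auto
  have fn: "class_fun E K \<pi> X \<Gamma>"
    using \<pi> unfolding ranking_def by blast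
  then have \<pi>K: "\<pi> \<in> K" and \<pi>_sub: "\<pi> \<subseteq> cprod E X \<Gamma>"
    unfolding class_fun_def by auto
  have app: "(x, app E \<pi> x) \<in> rel E \<pi>" if "x \<in> X" for x
    using app_eq_iff[OF fn that] by blast
  have "\<exists>\<rho>. continuous_ranking E K X R \<Gamma> L \<rho> \<and>
    (\<forall>x\<in>X. \<forall>c. (x, c) \<in> rel E \<pi> \<longrightarrow> (app E \<rho> x, c) \<in> rel E L)"
  proof (rule ex_continuous_ranking[OF R(1) L])
    show "fo (\<lambda>s. (s 1, s 0) \<in> rel E \<pi>)"
      by (intro definable_intros \<pi>K)
    show "c \<in> \<Gamma>" if "(x, c) \<in> rel E \<pi>" for c x
      using rel_cprodD[OF \<pi>_sub that] by simp
    show "\<exists>c. (x, c) \<in> rel E \<pi>" if "x \<in> X" for x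
      using app[OF that] by blast
    show "\<exists>d. (d, c) \<in> strict E L \<and> (a, d) \<in> rel E \<pi>"
      if "(x, c) \<in> rel E \<pi>" "(a, x) \<in> rel E R" for c x a
    proof -
      have "a \<in> X" "x \<in> X"
        using rel_cprodD[OF R(2) that(2)] by auto
      moreover have "(app E \<pi> a, app E \<pi> x) \<in> strict E L"
        using \<pi> that(2) unfolding ranking_def by blast
      ultimately show ?thesis
        using app app_eq_iff[OF fn] that(1) by metis
    qed
  qed
  then show ?thesis
    using app by blast
qed

end

theorem theorem5:
  fixes E :: "'a mem" and K :: "'a set set"
  assumes "GBC_minus E K" and "ETR E K"
  shows "(\<forall>X R. wf_class_rel E K X R \<longrightarrow>
            (\<exists>\<Gamma> L \<rho>. class_well_order E K \<Gamma> L \<and> continuous_ranking E K X R \<Gamma> L \<rho>)) \<and>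
         (\<forall>X R \<Gamma> L \<pi>. wf_class_rel E K X R \<longrightarrow> class_well_order E K \<Gamma> L \<longrightarrow>
            ranking E K X R \<Gamma> L \<pi> \<longrightarrow>
            (\<exists>\<rho>. continuous_ranking E K X R \<Gamma> L \<rho> \<and>
                 (\<forall>x\<in>X. (app E \<rho> x, app E \<pi> x) \<in> rel E L)))"
proof -
  interpret GBC_ETR E K
    by (simp add: GBC_ETR_def GBC_def GBC_ETR_axioms_def assms)
  show ?thesis
    using ex_class_ranking refine_class_ranking by blast
qed

end
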